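(* Let $(\mathcal{E},d,\preceq)$ be an ordered Polish space and let $P$ be a stochastically monotone Markov kernel on $\mathcal{E}$. Assume that the set $M=\{(x,y)\in\mathcal{E}\times\mathcal{E}: x\preceq y\}$ is achievable, and fix, for every $(x,y)\in\mathcal{E}\times\mathcal{E}$, a marginally Markovian $(x,y)$-coupling for which the hitting time $\tau_{x,y}(M)=\min\{n\ge 0: (X_n^x,X_n^y)\in M\}$ is almost surely finite (an $M$-successful family). Then: (i) For any $x,y\in\mathcal{E}$ and every $n$, $$\sup_{g\in\mathcal{G}}\big|\mathbf{E}g(X_n^x)-\mathbf{E}g(X_n^y)\big|\le \max\Big\{\mathbf{P}\big(\tau_{x,y}(M)>n\big),\ \mathbf{P}\big(\tau_{y,x}(M)>n\big)\Big\},$$ and the right-hand side tends to $0$ as $n\to\infty$. If, additionally, there exists a stationary distribution $\pi$ for the Markov chain, then $\pi$ is unique and the following hold: (ii) For each $x\in\mathcal{E}$, $$\lim_{n\to\infty}\sup_{g\in\mathcal{G}}\Big|\mathbf{E}g(X_n^x)-\int g(y)\,d\pi(y)\Big|\le \lim_{n\to\infty}\sup_{g\in\mathcal{G}}\int\big|\mathbf{E}g(X_n^x)-\mathbf{E}g(X_n^y)\big|\,d\pi(y)=0.$$ (iii) If, in addition, $\mathcal{E}$ is KS-normal, then, for every $y\in\mathcal{E}$, the distribution of $X_n^y$ converges to $\pi$ weakly as $n\to\infty$. (iv) If, for some $x\in\mathcal{E}$, the laws of $X_n^x$, $n\in\mathbb{N}_0$, are tight, then they converge to $\pi$ weakly (even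 if $\mathcal{E}$ is not KS-normal).
   Context: An ordered Polish space is a Polish (complete separable metric) space $(\mathcal{E},d)$ with its Borel $\sigma$-algebra and a partial order $\preceq$ such that $M=\{(x,y): x\preceq y\}$ is closed in $\mathcal{E}\times\mathcal{E}$. $\mathcal{G}$ denotes the set of all measurable functions $g:\mathcal{E}\to[0,1]$ that are increasing, i.e. $x\preceq y$ implies $g(x)\le g(y)$. A Markov kernel $P(x,A)$ on $\mathcal{E}$ is a probability measure in $A$ for each $x$ and measurable in $x$ for each Borel $A$; no Feller (continuity) property is assumed. $P$ is stochastically monotone if $g\in\mathcal{G}$ implies $Pg\in\mathcal{G}$, where $Pg(x)=\int g(y)P(x,dy)$. $(X_n^x)_{n\in\mathbb{N}_0}$ denotes the time-homogeneous Markov chain with kernel $P$ and $X_0^x=x$. A stationary distribution is a probability measure $\pi$ on $\mathcal{E}$ with $\int P(x,\cdot)\,d\pi(x)=\pi$. For $x,y\in\mathcal{E}$, a marginally Markovian $(x,y)$-coupling is a sequence of pairs $(X_n^x,X_n^y)_{n\in\mathbb{N}_0}$ of $\mathcal{E}$-valued random variables on a common probability space with $X_0^x=x$, $X_0^y=y$, such that for every $n\in\mathbb{N}_0$, almost surely, $$\mathbf{P}\big(X^x_{n+1}\in\cdot\,|\,\sigma(X^x_k,X^y_k)_{k\le n}\big)=P(X_n^x,\cdot),\qquad \mathbf{P}\big(X^y_{n+1}\in\cdot\,|\,\sigma(X^x_k,X^y_k)_{k\le n}\big)=P(X_n^y,\cdot).$$ A measurable set $H\subseteq\mathcal{E}\times\mathcal{E}$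 is achievable if for every pair $(x,y)\in\mathcal{E}\times\mathcal{E}$ there is a marginally Markovian $(x,y)$-coupling such that $\tau_{x,y}(H)=\min\{n\ge 0: (X_n^x,X_n^y)\in H\}$ is almost surely finite. (The quantities $\mathbf{E}g(X_n^x)$ depend only on the law of $X_n^x$, not on the coupling.) For $K\subseteq\mathcal{E}$, let $i(K)=\{x\in\mathcal{E}: x\succeq y\text{ for some }y\in K\}$ and $d(K)=\{x\in\mathcal{E}: x\preceq y\text{ for some }y\in K\}$. $\mathcal{E}$ is KS-normal if for every compact $C\subseteq\mathcal{E}$ the set $i(C)\cap d(C)$ is compact. *)

theory Defs
  imports "HOL-Probability.Probability"
begin

definition order_graph :: "('a::order \<times> 'a) set" where
  "order_graph = {(x, y). x \<le> y}"

text \<open>An ordered Polish space is a type of sort \<open>{polish_space, order}\<close> whose \<^const>\<open>order_graph\<close>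
  is closed. Markov kernels are the elements of \<^term>\<open>borel \<rightarrow>\<^sub>M prob_algebra borel\<close>.\<close>

definition increasing_functions :: "('a::{topological_space, order} \<Rightarrow> real) set" where
  "increasing_functions = {g \<in> borel_measurable borel. mono g \<and> (\<forall>x. 0 \<le> g x \<and> g x \<le> 1)}"

definition stochastically_monotone :: "('a::{topological_space, order} \<Rightarrow> 'a measure) \<Rightarrow> bool" where
  "stochastically_monotone P \<longleftrightarrow>
     (\<forall>g\<in>increasing_functions. (\<lambda>x. \<integral>y. g y \<partial>P x) \<in> increasing_functions)"

text \<open>Here \<^term>\<open>Giry_Monad.bind \<pi> P\<close> is the measure \<open>A \<mapsto> \<integral> P(x, A) d\<pi>(x)\<close>.\<close>

definition stationary_distribution ::
    "('a::topological_space \<Rightarrow> 'a measure) \<Rightarrow> 'a measure \<Rightarrow> bool" where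
  "stationary_distribution P \<pi> \<longleftrightarrow> prob_space \<pi> \<and> sets \<pi> = sets borel \<and> Giry_Monad.bind \<pi> P = \<pi>"

text \<open>The sigma-algebra on the sample space generated by \<open>Z\<^sub>0, \<dots>, Z\<^sub>n\<close>. For \<open>Z\<^sub>k = (X\<^sub>k, Y\<^sub>k)\<close> in a
  second countable space the Borel sets of the product are generated by the rectangles, so this
  is the sigma-algebra generated by all \<open>X\<^sub>k\<close> and \<open>Y\<^sub>k\<close> with \<open>k \<le> n\<close>.\<close>

definition history :: "'w measure \<Rightarrow> (nat \<Rightarrow> 'w \<Rightarrow> 'b::topological_space) \<Rightarrow> nat \<Rightarrow> 'w measure" where
  "history M Z n = sigma (space M) {Z k -` A \<inter> space M | k A. k \<le> n \<and> A \<in> sets borel}"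

text \<open>\<open>\<P>(X\<^sub>n\<^sub>+\<^sub>1 \<in> A | \<F>\<^sub>n) = P(X\<^sub>n, A)\<close> almost surely, for every \<open>n\<close> and every Borel set \<open>A\<close>.\<close>

definition markov_transitions ::
    "'w measure \<Rightarrow> (nat \<Rightarrow> 'w measure) \<Rightarrow> ('a::topological_space \<Rightarrow> 'a measure) \<Rightarrow>
     (nat \<Rightarrow> 'w \<Rightarrow> 'a) \<Rightarrow> bool" where
  "markov_transitions M F P X \<longleftrightarrow>
     (\<forall>n. \<forall>A\<in>sets borel. AE \<omega> in M.
        real_cond_exp M (F n) (\<lambda>\<omega>. indicator A (X (Suc n) \<omega>)) \<omega> = measure (P (X n \<omega>)) A)"

definition markov_chain ::
    "('a::topological_space \<Rightarrow> 'a measure) \<Rightarrow> 'a \<Rightarrow> 'w measure \<Rightarrow> (nat \<Rightarrow> 'w \<Rightarrow> 'a) \<Rightarrow> bool" where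
  "markov_chain P x M X \<longleftrightarrow>
     prob_space M \<and> (\<forall>n. X n \<in> borel_measurable M) \<and> (\<forall>\<omega>\<in>space M. X 0 \<omega> = x) \<and>
     markov_transitions M (history M X) P X"

definition marginally_markovian_coupling ::
    "('a::topological_space \<Rightarrow> 'a measure) \<Rightarrow> 'a \<Rightarrow> 'a \<Rightarrow> 'w measure \<Rightarrow>
     (nat \<Rightarrow> 'w \<Rightarrow> 'a) \<Rightarrow> (nat \<Rightarrow> 'w \<Rightarrow> 'a) \<Rightarrow> bool" where
  "marginally_markovian_coupling P x y M X Y \<longleftrightarrow>
     prob_space M \<and>
     (\<forall>n. X n \<in> borel_measurable M) \<and> (\<forall>n. Y n \<in> borel_measurable M) \<and>
     (\<forall>\<omega>\<in>space M. X 0 \<omega> = x) \<and> (\<forall>\<omega>\<in>space M. Y 0 \<omega> = y) \<and>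
     markov_transitions M (history M (\<lambda>k \<omega>. (X k \<omega>, Y k \<omega>))) P X \<and>
     markov_transitions M (history M (\<lambda>k \<omega>. (X k \<omega>, Y k \<omega>))) P Y"

text \<open>The infimum of the empty set in \<^typ>\<open>enat\<close> is \<open>\<infinity>\<close>.\<close>

definition hitting_time ::
    "('a \<times> 'a) set \<Rightarrow> (nat \<Rightarrow> 'w \<Rightarrow> 'a) \<Rightarrow> (nat \<Rightarrow> 'w \<Rightarrow> 'a) \<Rightarrow> 'w \<Rightarrow> enat" where
  "hitting_time H X Y \<omega> = Inf {enat n | n. (X n \<omega>, Y n \<omega>) \<in> H}"

definition successful_coupling ::
    "('a::topological_space \<Rightarrow> 'a measure) \<Rightarrow> ('a \<times> 'a) set \<Rightarrow> 'a \<Rightarrow> 'a \<Rightarrow> 'w measure \<Rightarrow>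
     (nat \<Rightarrow> 'w \<Rightarrow> 'a) \<Rightarrow> (nat \<Rightarrow> 'w \<Rightarrow> 'a) \<Rightarrow> bool" where
  "successful_coupling P H x y M X Y \<longleftrightarrow>
     marginally_markovian_coupling P x y M X Y \<and> (AE \<omega> in M. hitting_time H X Y \<omega> < \<infinity>)"

text \<open>HOL cannot quantify existentially over the type of sample points, so that type is a
  parameter.\<close>

definition achievable ::
    "'w itself \<Rightarrow> ('a::topological_space \<Rightarrow> 'a measure) \<Rightarrow> ('a \<times> 'a) set \<Rightarrow> bool" where
  "achievable (_ :: 'w itself) P H \<longleftrightarrow>
     H \<in> sets borel \<and> (\<forall>x y. \<exists>(M :: 'w measure) X Y. successful_coupling P H x y M X Y)"

definition increasing_hull :: "'a::order set \<Rightarrow> 'a set" where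
  "increasing_hull K = {x. \<exists>y\<in>K. y \<le> x}"

definition decreasing_hull :: "'a::order set \<Rightarrow> 'a set" where
  "decreasing_hull K = {x. \<exists>y\<in>K. x \<le> y}"

definition KS_normal :: "'a::{topological_space, order} itself \<Rightarrow> bool" where
  "KS_normal (_ :: 'a itself) \<longleftrightarrow>
     (\<forall>C :: 'a set. compact C \<longrightarrow> compact (increasing_hull C \<inter> decreasing_hull C))"

text \<open>The library has weak convergence and tightness only for measures on the reals
  (\<^const>\<open>weak_conv_m\<close>, \<^const>\<open>tight\<close>).\<close>

definition converges_weakly :: "(nat \<Rightarrow> 'a::topological_space measure) \<Rightarrow> 'a measure \<Rightarrow> bool" where
  "converges_weakly \<mu> \<nu> \<longleftrightarrow>
     (\<forall>f :: 'a \<Rightarrow> real. continuous_on UNIV f \<and> bounded (range f) \<longrightarrow>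
        (\<lambda>n. \<integral>x. f x \<partial>\<mu> n) \<longlonglongrightarrow> (\<integral>x. f x \<partial>\<nu>))"

definition tight_sequence :: "(nat \<Rightarrow> 'a::topological_space measure) \<Rightarrow> bool" where
  "tight_sequence \<mu> \<longleftrightarrow> (\<forall>\<epsilon>>0. \<exists>K. compact K \<and> (\<forall>n. measure (\<mu> n) K > 1 - \<epsilon>))"

end

theory Submission
  imports Defs
begin

text \<open>
  A coupling that hits the order relation at time \<open>\<tau>\<close> gives \<open>E g(X\<^sub>n) \<le> E g(Y\<^sub>n) + P(\<tau> > n)\<close>
  for increasing \<open>g\<close>: on \<open>{\<tau> = k}\<close> with \<open>k \<le> n\<close> the Markov property of each coordinate at time
  \<open>k\<close> replaces \<open>g(X\<^sub>n)\<close> and \<open>g(Y\<^sub>n)\<close> by \<open>P\<^sup>n\<^sup>-\<^sup>kg\<close> at the two positions, which are ordered,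
  and \<open>P\<^sup>n\<^sup>-\<^sup>kg\<close> is increasing (\<open>coupling_order_after_hitting\<close>, \<open>coupling_inequality\<close>). The
  two couplings started from \<open>(x, y)\<close> and \<open>(y, x)\<close> give both signs, and the tails vanish since
  \<open>\<tau>\<close> is almost surely finite.

  For a stationary \<open>\<pi>\<close> the pointwise bound has to be integrated over the starting point \<open>y\<close>.
  Nothing says that the couplings, or the supremum over \<open>g\<close>, depend measurably on \<open>y\<close>. One
  therefore picks for each \<open>n\<close> a single \<open>g\<^sub>n\<close> that nearly attains the supremum of the averaged
  difference; for this sequence the integrands are measurable, bounded and tend to zero at
  every \<open>y\<close>, so dominated convergence applies (\<open>kernel_op_uniform_averaging\<close>).

  What remains is to pass from increasing functions to weak convergence, where there may be
  few continuous increasing functions. The linear span of the measurable increasing functions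
  into \<open>[0, 1]\<close> is an algebra, since a product of two such functions is again one, and
  integrals of its members converge. If \<open>K\<close> is compact, the closed sets \<open>i(C)\<close> and \<open>d(C)\<close> for
  compact \<open>C\<close> separate any two points of \<open>K\<close> with a neighbourhood to spare, because the order
  is closed and antisymmetric. A compactness argument in the style of Stone and Weierstrass
  then shows that every continuous function into \<open>[0, 1]\<close> is uniformly close on \<open>K\<close> to a
  member of the span (\<open>span_approximates_continuous\<close>). Tightness lets \<open>K\<close> carry almost all the
  mass, so weak convergence follows without passing to subsequential limits
  (\<open>weak_convergence_if_tight\<close>). A constant sequence is tight, hence increasing functions
  determine a probability measure, and \<open>\<pi>\<close> is unique. In a KS-normal space, convergence on the
  increasing sets \<open>i(C)\<close> and on the complements of \<open>d(C)\<close> forces the mass into the compact set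
  \<open>i(C) \<inter> d(C)\<close>, which supplies the tightness (\<open>tight_if_KS_normal\<close>).
\<close>

section \<open>Increasing functions and one step of the Markov property\<close>

lemma kernel_prob:
  assumes "P \<in> borel \<rightarrow>\<^sub>M prob_algebra borel"
  shows "prob_space (P x)" "sets (P x) = sets borel"
proof -
  have "P x \<in> space (prob_algebra borel)"
    using measurable_space[OF assms, of x] by simp
  then show "prob_space (P x)" "sets (P x) = sets borel"
    by (auto simp: space_prob_algebra)
qed

lemma increasing_functionsD:
  assumes "g \<in> increasing_functions"
  shows "g \<in> borel_measurable borel" "mono g" "0 \<le> g x" "g x \<le> 1" "\<bar>g x\<bar> \<le> 1"
  using assms unfolding increasing_functions_def by (auto simp: abs_le_iff intro: order_trans[of _ 0])

lemma integrable_increasing: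
  assumes "prob_space M" "f \<in> M \<rightarrow>\<^sub>M borel" "g \<in> increasing_functions"
  shows "integrable M (\<lambda>\<omega>. g (f \<omega>))"
proof -
  interpret prob_space M by fact
  note [measurable] = increasing_functionsD(1)[OF assms(3)] assms(2)
  show ?thesis
    by (rule integrable_const_bound[of _ 1]) (use increasing_functionsD[OF assms(3)] in auto)
qed

lemma bind_integral_increasing:
  assumes P: "P \<in> borel \<rightarrow>\<^sub>M prob_algebra borel"
    and "finite_measure \<mu>" "sets \<mu> = sets borel" "g \<in> increasing_functions"
  shows "(\<integral>x. g x \<partial>Giry_Monad.bind \<mu> P) = (\<integral>x. (\<integral>y. g y \<partial>P x) \<partial>\<mu>)"
proof -
  have P': "P \<in> \<mu> \<rightarrow>\<^sub>M subprob_algebra borel"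
    using measurable_prob_algebraD[OF P] assms(3) by (simp cong: measurable_cong_sets)
  have "space \<mu> = UNIV" using sets_eq_imp_space_eq[OF assms(3)] by simp
  interpret finite_measure \<mu> by fact
  show ?thesis
  proof (rule integral_bind[where K = borel and B = 1 and B' = 1])
    show "AE x in \<mu>. emeasure (P x) (space (P x)) \<le> ennreal 1"
      using prob_space.emeasure_space_1[OF kernel_prob(1)[OF P]] by auto
  qed (use assms increasing_functionsD[OF assms(4)] finite_measure_axioms P' in auto)
qed

text \<open>The hypothesis only speaks of indicators \<open>g = 1\<^sub>B\<close>. Both sides are integrals of \<open>g\<close>: against
  the law of \<open>X\<^sub>n\<^sub>+\<^sub>1\<close> restricted to the event \<open>A\<close>, and against the law of \<open>X\<^sub>n\<close> restricted to
  \<open>A\<close> followed by one step of \<open>P\<close>. The case of indicators says that these two measures agree.\<close>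

lemma markov_transitions_integral:
  fixes P :: "'a::{topological_space, order} \<Rightarrow> 'a measure" and F :: "nat \<Rightarrow> 'w measure"
  assumes M: "prob_space M" and sub: "subalgebra M (F n)"
    and X[measurable]: "\<And>k. X k \<in> borel_measurable M"
    and P: "P \<in> borel \<rightarrow>\<^sub>M prob_algebra borel"
    and markov: "markov_transitions M F P X"
    and A: "A \<in> sets (F n)" and g: "g \<in> increasing_functions"
  shows "(\<integral>\<omega>. indicator A \<omega> * g (X (Suc n) \<omega>) \<partial>M)
    = (\<integral>\<omega>. indicator A \<omega> * (\<integral>y. g y \<partial>P (X n \<omega>)) \<partial>M)"
proof -
  interpret prob_space M by fact
  interpret finite_measure_subalgebra M "F n"
    using sub by unfold_locales
  have [measurable]: "A \<in> sets M" using A sub by (auto simp: subalgebra_def)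
  note [measurable] = increasing_functionsD(1)[OF g]
  have P'[measurable]: "P \<in> borel \<rightarrow>\<^sub>M subprob_algebra borel"
    by (rule measurable_prob_algebraD[OF P])
  define D where "D = density M (\<lambda>\<omega>. ennreal (indicator A \<omega>))"
  have D[simp]: "sets D = sets M" "space D = space M" by (simp_all add: D_def)
  have XD: "X k \<in> borel_measurable D" for k
    using X[of k] by (simp cong: measurable_cong_sets)
  have fin_D: "finite_measure D"
    unfolding D_def
    by (rule finite_measureI) (simp add: ennreal_indicator emeasure_restricted)
  define \<nu>1 where "\<nu>1 = distr D borel (X (Suc n))"
  define \<nu>2 where "\<nu>2 = Giry_Monad.bind (distr D borel (X n)) P"
  have eq: "\<nu>1 = \<nu>2"
  proof (rule measure_eqI)
    have ne: "space (distr D borel (X n)) \<noteq> {}" by simp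
    show "sets \<nu>1 = sets \<nu>2"
      unfolding \<nu>1_def \<nu>2_def using P' by (subst sets_bind[where N=borel]) (auto simp: kernel_prob[OF P])
    fix B assume "B \<in> sets \<nu>1"
    then have [measurable]: "B \<in> sets borel" by (simp add: \<nu>1_def)
    have "emeasure \<nu>1 B = (\<integral>\<^sup>+\<omega>. indicator A \<omega> * indicator B (X (Suc n) \<omega>) \<partial>M)"
      unfolding \<nu>1_def
      by (simp add: nn_integral_distr XD flip: nn_integral_indicator)
         (simp add: D_def nn_integral_density ennreal_indicator)
    also have "\<dots> = (\<integral>\<^sup>+\<omega>. ennreal (indicator A \<omega> * indicator B (X (Suc n) \<omega>)) \<partial>M)"
      by (intro nn_integral_cong) (auto split: split_indicator)
    also have "\<dots> = ennreal (\<integral>\<omega>. indicator A \<omega> * indicator B (X (Suc n) \<omega>) \<partial>M)"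
      by (intro nn_integral_eq_integral integrable_const_bound[of _ 1]) (auto split: split_indicator)
    also have "(\<integral>\<omega>. indicator A \<omega> * indicator B (X (Suc n) \<omega>) \<partial>M)
        = (\<integral>\<omega>. indicator A \<omega> * real_cond_exp M (F n) (\<lambda>\<omega>. indicator B (X (Suc n) \<omega>)) \<omega> \<partial>M)"
      using A by (intro real_cond_exp_intg(2)[symmetric] integrable_const_bound[of _ 1])
        (auto split: split_indicator)
    also have "\<dots> = (\<integral>\<omega>. indicator A \<omega> * measure (P (X n \<omega>)) B \<partial>M)"
    proof (rule integral_cong_AE)
      have "AE \<omega> in M. real_cond_exp M (F n) (\<lambda>\<omega>. indicator B (X (Suc n) \<omega>)) \<omega>
          = measure (P (X n \<omega>)) B"
        using markov \<open>B \<in> sets borel\<close> unfolding markov_transitions_def by blast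
      then show "AE \<omega> in M. indicator A \<omega> * real_cond_exp M (F n)
          (\<lambda>\<omega>. indicator B (X (Suc n) \<omega>)) \<omega> = indicator A \<omega> * measure (P (X n \<omega>)) B"
        by eventually_elim simp
    qed measurable
    also have "ennreal \<dots> = (\<integral>\<^sup>+\<omega>. ennreal (indicator A \<omega> * measure (P (X n \<omega>)) B) \<partial>M)"
      by (intro nn_integral_eq_integral[symmetric] integrable_const_bound[of _ 1])
        (auto split: split_indicator simp: prob_space.prob_le_1[OF kernel_prob(1)[OF P]])
    also have "\<dots> = (\<integral>\<^sup>+\<omega>. indicator A \<omega> * emeasure (P (X n \<omega>)) B \<partial>M)"
      using prob_space.finite_measure[OF kernel_prob(1)[OF P]]
      by (intro nn_integral_cong) (auto split: split_indicator simp: finite_measure.emeasure_eq_measure)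
    also have "\<dots> = emeasure \<nu>2 B"
      unfolding \<nu>2_def
      apply (subst emeasure_bind[OF ne, where N=borel])
      using P' apply (simp, simp)
      apply (simp add: nn_integral_distr XD)
      apply (simp add: D_def nn_integral_density ennreal_indicator)
      done
    finally show "emeasure \<nu>1 B = emeasure \<nu>2 B" .
  qed
  have weighted: "(\<integral>x. f x \<partial>distr D borel (X k)) = (\<integral>\<omega>. indicator A \<omega> * f (X k \<omega>) \<partial>M)"
    if f: "f \<in> borel_measurable borel" for f :: "'a \<Rightarrow> real" and k
  proof -
    have [measurable]: "(\<lambda>\<omega>. f (X k \<omega>)) \<in> borel_measurable M"
      by (rule measurable_compose[OF X f])
    show ?thesis
      unfolding integral_distr[OF XD f]
      unfolding D_def by (rule integral_real_density) simp_all
  qed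
  have Pg: "(\<lambda>x. \<integral>y. g y \<partial>P x) \<in> borel_measurable borel"
    by (rule measurable_compose[OF P' integral_measurable_subprob_algebra[OF increasing_functionsD(1)[OF g]]])
  have "(\<integral>\<omega>. indicator A \<omega> * g (X (Suc n) \<omega>) \<partial>M) = (\<integral>x. g x \<partial>\<nu>1)"
    unfolding \<nu>1_def by (rule weighted[OF increasing_functionsD(1)[OF g], symmetric])
  also have "\<dots> = (\<integral>x. (\<integral>y. g y \<partial>P x) \<partial>distr D borel (X n))"
    unfolding eq \<nu>2_def
    by (rule bind_integral_increasing[OF P _ _ g])
      (simp_all add: finite_measure.finite_measure_distr[OF fin_D XD])
  also have "\<dots> = (\<integral>\<omega>. indicator A \<omega> * (\<integral>y. g y \<partial>P (X n \<omega>)) \<partial>M)"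
    by (rule weighted[OF Pg])
  finally show ?thesis .
qed

section \<open>Coupling up to the time of meeting in the order\<close>

text \<open>The operator \<open>g \<mapsto> Pg\<close>; its iterates \<open>P\<^sup>ng\<close> describe the laws of the chain without reference
  to any particular probability space.\<close>

definition kernel_op :: "('a \<Rightarrow> 'a measure) \<Rightarrow> ('a \<Rightarrow> real) \<Rightarrow> 'a \<Rightarrow> real" where
  "kernel_op P g = (\<lambda>x. \<integral>y. g y \<partial>P x)"

lemma kernel_op_increasing:
  assumes "stochastically_monotone P" "g \<in> increasing_functions"
  shows "(kernel_op P ^^ n) g \<in> increasing_functions"
  using assms by (induction n) (auto simp: stochastically_monotone_def kernel_op_def)

lemma subalgebra_history:
  assumes "\<And>k. Z k \<in> borel_measurable M"
  shows "subalgebra M (history M Z n)"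
  unfolding subalgebra_def history_def using assms
  by (auto simp: space_measure_of_conv sets_measure_of_conv measurable_sets
      intro!: sets.sigma_sets_subset)

lemma history_measurable:
  assumes "k \<le> n" "A \<in> sets borel"
  shows "Z k -` A \<inter> space M \<in> sets (history M Z n)"
  unfolding history_def using assms by (intro in_measure_of) auto

text \<open>The filtration is left open so that the result covers both a chain with its own history and
  each coordinate of a coupling with the joint history; this is why the law of a coordinate
  does not depend on the coupling.\<close>

lemma markov_expectation:
  fixes P :: "'a::{topological_space, order} \<Rightarrow> 'a measure"
  assumes M: "prob_space M" and sub: "\<And>n. subalgebra M (F n)"
    and X: "\<And>k. X k \<in> borel_measurable M"
    and P: "P \<in> borel \<rightarrow>\<^sub>M prob_algebra borel" and mono: "stochastically_monotone P"
    and markov: "markov_transitions M F P X" and start: "\<And>\<omega>. \<omega> \<in> space M \<Longrightarrow> X 0 \<omega> = x"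
    and g: "g \<in> increasing_functions"
  shows "(\<integral>\<omega>. g (X n \<omega>) \<partial>M) = (kernel_op P ^^ n) g x"
  using g
proof (induction n arbitrary: g)
  case 0
  have "(\<integral>\<omega>. g (X 0 \<omega>) \<partial>M) = (\<integral>\<omega>. g x \<partial>M)"
    by (intro Bochner_Integration.integral_cong) (auto simp: start)
  then show ?case using prob_space.prob_space[OF M] by simp
next
  case (Suc n)
  have sp: "space M \<in> sets (F n)"
    using sub by (metis sets.top subalgebra_def)
  have ind: "(\<integral>\<omega>. indicator (space M) \<omega> * f \<omega> \<partial>M) = (\<integral>\<omega>. f \<omega> \<partial>M)" for f :: "_ \<Rightarrow> real"
    by (intro Bochner_Integration.integral_cong) auto
  have "(\<integral>\<omega>. g (X (Suc n) \<omega>) \<partial>M) = (\<integral>\<omega>. kernel_op P g (X n \<omega>) \<partial>M)"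
    using markov_transitions_integral[where F = F and n = n, OF M sub X P markov sp Suc.prems]
    unfolding ind kernel_op_def .
  also have "\<dots> = (kernel_op P ^^ n) (kernel_op P g) x"
    using kernel_op_increasing[OF mono Suc.prems, of 1] by (intro Suc.IH) simp
  finally show ?case by (simp add: funpow_swap1)
qed

lemma hitting_time_le_iff: "hitting_time H X Y \<omega> \<le> enat n \<longleftrightarrow> (\<exists>k\<le>n. (X k \<omega>, Y k \<omega>) \<in> H)"
proof
  let ?A = "{enat n | n. (X n \<omega>, Y n \<omega>) \<in> H}"
  assume le: "hitting_time H X Y \<omega> \<le> enat n"
  have "?A \<noteq> {}"
  proof
    assume "?A = {}"
    then have "hitting_time H X Y \<omega> = \<infinity>" unfolding hitting_time_def by (simp add: top_enat_def)
    with le show False by simp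
  qed
  then obtain a where "a \<in> ?A" by (meson ex_in_conv)
  then have "Inf ?A \<in> ?A" by (rule wellorder_InfI)
  with le show "\<exists>k\<le>n. (X k \<omega>, Y k \<omega>) \<in> H" unfolding hitting_time_def by auto
next
  assume "\<exists>k\<le>n. (X k \<omega>, Y k \<omega>) \<in> H"
  then obtain k where k: "k \<le> n" "(X k \<omega>, Y k \<omega>) \<in> H" by blast
  then have "hitting_time H X Y \<omega> \<le> enat k" unfolding hitting_time_def by (intro Inf_lower) auto
  with k(1) show "hitting_time H X Y \<omega> \<le> enat n" by (meson enat_ord_simps(1) order_trans)
qed

lemma hitting_time_le_history:
  fixes X Y :: "nat \<Rightarrow> 'w \<Rightarrow> 'a::second_countable_topology"
  assumes "H \<in> sets borel"
  shows "{\<omega> \<in> space M. hitting_time H X Y \<omega> \<le> enat n} \<in> sets (history M (\<lambda>k \<omega>. (X k \<omega>, Y k \<omega>)) n)"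
proof -
  have "{\<omega> \<in> space M. hitting_time H X Y \<omega> \<le> enat n}
      = (\<Union>k\<le>n. (\<lambda>\<omega>. (X k \<omega>, Y k \<omega>)) -` H \<inter> space M)"
    by (auto simp: hitting_time_le_iff)
  also have "\<dots> \<in> sets (history M (\<lambda>k \<omega>. (X k \<omega>, Y k \<omega>)) n)"
    using history_measurable[OF _ assms, where Z = "\<lambda>k \<omega>. (X k \<omega>, Y k \<omega>)"]
    by (intro sets.finite_UN) auto
  finally show ?thesis .
qed

lemma subalgebra_history_pair:
  fixes X Y :: "nat \<Rightarrow> 'w \<Rightarrow> 'a::second_countable_topology"
  assumes "\<And>k. X k \<in> borel_measurable M" "\<And>k. Y k \<in> borel_measurable M"
  shows "subalgebra M (history M (\<lambda>k \<omega>. (X k \<omega>, Y k \<omega>)) n)"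
  by (rule subalgebra_history) (rule borel_measurable_Pair[OF assms])

lemma hitting_time_le_measurable:
  fixes X Y :: "nat \<Rightarrow> 'w \<Rightarrow> 'a::second_countable_topology"
  assumes "H \<in> sets borel" "\<And>k. X k \<in> borel_measurable M" "\<And>k. Y k \<in> borel_measurable M"
  shows "{\<omega> \<in> space M. hitting_time H X Y \<omega> \<le> enat n} \<in> sets M"
proof -
  have "subalgebra M (history M (\<lambda>k \<omega>. (X k \<omega>, Y k \<omega>)) n)"
    by (rule subalgebra_history_pair[OF assms(2,3)])
  then have "sets (history M (\<lambda>k \<omega>. (X k \<omega>, Y k \<omega>)) n) \<subseteq> sets M"
    by (simp add: subalgebra_def)
  then show ?thesis
    by (rule subsetD) (rule hitting_time_le_history[OF assms(1)])
qed

text \<open>Induction on \<open>n\<close> for all \<open>g\<close> at once replaces the strong Markov property. The event that the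
  hitting time is at most \<open>n + 1\<close> splits into the event that it is at most \<open>n\<close>, which belongs
  to the history up to time \<open>n\<close>, so that one step of the kernel reduces to the induction
  hypothesis for \<open>Pg\<close>; and the event that it equals \<open>n + 1\<close>, where the two positions at time
  \<open>n + 1\<close> are ordered.\<close>

lemma coupling_order_after_hitting:
  fixes P :: "'a::{polish_space, order} \<Rightarrow> 'a measure"
  assumes closed: "closed (order_graph :: ('a \<times> 'a) set)"
    and P: "P \<in> borel \<rightarrow>\<^sub>M prob_algebra borel" and mono: "stochastically_monotone P"
    and coupling: "marginally_markovian_coupling P x y M X Y" and g: "g \<in> increasing_functions"
  defines "A \<equiv> \<lambda>n. {\<omega> \<in> space M. hitting_time order_graph X Y \<omega> \<le> enat n}"
  shows "(\<integral>\<omega>. indicator (A n) \<omega> * g (X n \<omega>) \<partial>M) \<le> (\<integral>\<omega>. indicator (A n) \<omega> * g (Y n \<omega>) \<partial>M)"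
  using g
proof (induction n arbitrary: g)
  case (0 g)
  have M: "prob_space M" and X: "\<And>n. X n \<in> borel_measurable M" and Y: "\<And>n. Y n \<in> borel_measurable M"
    using coupling unfolding marginally_markovian_coupling_def by auto
  have A: "A n \<in> sets M" for n
    unfolding A_def by (rule hitting_time_le_measurable[OF borel_closed[OF closed] X Y])
  have int: "integrable M (\<lambda>\<omega>. indicator (A 0) \<omega> * g (Z \<omega>))" if "Z \<in> borel_measurable M" for Z
    using integrable_mult_indicator[OF A integrable_increasing[OF M that 0]] by simp
  show ?case
    by (rule integral_mono[OF int[OF X] int[OF Y]])
      (use monoD[OF increasing_functionsD(2)[OF 0]] in
        \<open>auto simp: A_def hitting_time_le_iff order_graph_def split: split_indicator\<close>)
next
  case (Suc n g)
  define F where "F = history M (\<lambda>k \<omega>. (X k \<omega>, Y k \<omega>))"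
  have M: "prob_space M" and X: "\<And>n. X n \<in> borel_measurable M" and Y: "\<And>n. Y n \<in> borel_measurable M"
    and mX: "markov_transitions M F P X" and mY: "markov_transitions M F P Y"
    using coupling unfolding marginally_markovian_coupling_def F_def by auto
  have sub: "subalgebra M (F n)" for n
    unfolding F_def by (rule subalgebra_history_pair[OF X Y])
  have AF: "A n \<in> sets (F n)" for n
    unfolding A_def F_def by (rule hitting_time_le_history[OF borel_closed[OF closed]])
  have A: "A n \<in> sets M" for n
    unfolding A_def by (rule hitting_time_le_measurable[OF borel_closed[OF closed] X Y])
  define B where "B = A (Suc n) - A n"
  have B: "B \<in> sets M" unfolding B_def using A by auto
  have int: "integrable M (\<lambda>\<omega>. indicator C \<omega> * g (Z \<omega>))"
    if "Z \<in> borel_measurable M" "C \<in> sets M" for Z C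
    using integrable_mult_indicator[OF that(2) integrable_increasing[OF M that(1) Suc.prems]] by simp
  have "A n \<subseteq> A (Suc n)"
    unfolding A_def by (auto simp: hitting_time_le_iff intro: le_SucI)
  then have "indicator (A (Suc n)) \<omega> = indicator (A n) \<omega> + (indicator B \<omega> :: real)" for \<omega>
    by (auto simp: B_def split: split_indicator)
  then have split: "(\<integral>\<omega>. indicator (A (Suc n)) \<omega> * g (Z (Suc n) \<omega>) \<partial>M)
      = (\<integral>\<omega>. indicator (A n) \<omega> * g (Z (Suc n) \<omega>) \<partial>M) + (\<integral>\<omega>. indicator B \<omega> * g (Z (Suc n) \<omega>) \<partial>M)"
    if "\<And>n. Z n \<in> borel_measurable M" for Z
    using int[OF that A] int[OF that B] by (simp add: distrib_right)
  have "(\<integral>\<omega>. indicator (A n) \<omega> * g (X (Suc n) \<omega>) \<partial>M) = (\<integral>\<omega>. indicator (A n) \<omega> * kernel_op P g (X n \<omega>) \<partial>M)"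
    unfolding kernel_op_def by (rule markov_transitions_integral[OF M sub X P mX AF Suc.prems])
  also have "\<dots> \<le> (\<integral>\<omega>. indicator (A n) \<omega> * kernel_op P g (Y n \<omega>) \<partial>M)"
    using kernel_op_increasing[OF mono Suc.prems, of 1] by (intro Suc.IH) simp
  also have "\<dots> = (\<integral>\<omega>. indicator (A n) \<omega> * g (Y (Suc n) \<omega>) \<partial>M)"
    unfolding kernel_op_def by (rule markov_transitions_integral[OF M sub Y P mY AF Suc.prems, symmetric])
  finally have before: "(\<integral>\<omega>. indicator (A n) \<omega> * g (X (Suc n) \<omega>) \<partial>M)
      \<le> (\<integral>\<omega>. indicator (A n) \<omega> * g (Y (Suc n) \<omega>) \<partial>M)" .
  have "X (Suc n) \<omega> \<le> Y (Suc n) \<omega>" if "\<omega> \<in> B" for \<omega>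
    using that by (auto simp: B_def A_def hitting_time_le_iff le_Suc_eq order_graph_def)
  then have now: "(\<integral>\<omega>. indicator B \<omega> * g (X (Suc n) \<omega>) \<partial>M) \<le> (\<integral>\<omega>. indicator B \<omega> * g (Y (Suc n) \<omega>) \<partial>M)"
    using monoD[OF increasing_functionsD(2)[OF Suc.prems]]
    by (intro integral_mono int X Y B) (auto split: split_indicator)
  show ?case
    unfolding split[of X, OF X] split[of Y, OF Y] by (rule add_mono[OF before now])
qed

text \<open>Before the hitting time nothing is known about the order of the two positions, but there
  \<open>g(X\<^sub>n)\<close> exceeds \<open>g(Y\<^sub>n)\<close> by at most 1.\<close>

lemma coupling_inequality:
  fixes P :: "'a::{polish_space, order} \<Rightarrow> 'a measure"
  assumes closed: "closed (order_graph :: ('a \<times> 'a) set)"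
    and P: "P \<in> borel \<rightarrow>\<^sub>M prob_algebra borel" and mono: "stochastically_monotone P"
    and coupling: "marginally_markovian_coupling P x y M X Y" and g: "g \<in> increasing_functions"
  shows "(kernel_op P ^^ n) g x - (kernel_op P ^^ n) g y
    \<le> measure M {\<omega> \<in> space M. hitting_time order_graph X Y \<omega> > enat n}"
proof -
  define F where "F = history M (\<lambda>k \<omega>. (X k \<omega>, Y k \<omega>))"
  define A where "A = {\<omega> \<in> space M. hitting_time order_graph X Y \<omega> \<le> enat n}"
  have M: "prob_space M" and X: "\<And>n. X n \<in> borel_measurable M" and Y: "\<And>n. Y n \<in> borel_measurable M"
    and mX: "markov_transitions M F P X" and mY: "markov_transitions M F P Y"
    and X0: "\<And>\<omega>. \<omega> \<in> space M \<Longrightarrow> X 0 \<omega> = x" and Y0: "\<And>\<omega>. \<omega> \<in> space M \<Longrightarrow> Y 0 \<omega> = y"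
    using coupling unfolding marginally_markovian_coupling_def F_def by auto
  interpret prob_space M by fact
  have sub: "subalgebra M (F n)" for n
    unfolding F_def by (rule subalgebra_history_pair[OF X Y])
  have A: "A \<in> sets M"
    unfolding A_def by (rule hitting_time_le_measurable[OF borel_closed[OF closed] X Y])
  have gX: "integrable M (\<lambda>\<omega>. g (X n \<omega>))" and gY: "integrable M (\<lambda>\<omega>. g (Y n \<omega>))"
    using integrable_increasing[OF M _ g] X Y by auto
  have iX: "integrable M (\<lambda>\<omega>. indicator A \<omega> * g (X n \<omega>))" and iY: "integrable M (\<lambda>\<omega>. indicator A \<omega> * g (Y n \<omega>))"
    using integrable_mult_indicator[OF A gX] integrable_mult_indicator[OF A gY] by simp_all
  have iC: "integrable M (indicator (space M - A) :: _ \<Rightarrow> real)"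
    using A by (simp add: emeasure_eq_measure)
  have "(kernel_op P ^^ n) g x = (\<integral>\<omega>. g (X n \<omega>) \<partial>M)"
    by (rule markov_expectation[OF M sub X P mono mX X0 g, symmetric])
  also have "\<dots> \<le> (\<integral>\<omega>. indicator A \<omega> * g (X n \<omega>) + indicator (space M - A) \<omega> \<partial>M)"
    using increasing_functionsD(4)[OF g]
    by (intro integral_mono Bochner_Integration.integrable_add gX iX iC) (auto split: split_indicator)
  also have "\<dots> = (\<integral>\<omega>. indicator A \<omega> * g (X n \<omega>) \<partial>M) + measure M (space M - A)"
    using iX iC A by simp
  also have "(\<integral>\<omega>. indicator A \<omega> * g (X n \<omega>) \<partial>M) \<le> (\<integral>\<omega>. indicator A \<omega> * g (Y n \<omega>) \<partial>M)"
    unfolding A_def by (rule coupling_order_after_hitting[OF closed P mono coupling g])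
  also have "\<dots> \<le> (\<integral>\<omega>. g (Y n \<omega>) \<partial>M)"
    using increasing_functionsD(3)[OF g] by (intro integral_mono gY iY) (auto split: split_indicator)
  also have "\<dots> = (kernel_op P ^^ n) g y"
    by (rule markov_expectation[OF M sub Y P mono mY Y0 g])
  also have "space M - A = {\<omega> \<in> space M. hitting_time order_graph X Y \<omega> > enat n}"
    by (auto simp: A_def)
  finally show ?thesis by simp
qed

lemma hitting_time_tail_tendsto_0:
  fixes P :: "'a::{second_countable_topology} \<Rightarrow> 'a measure"
  assumes H: "H \<in> sets borel" and coupling: "successful_coupling P H x y M X Y"
  shows "(\<lambda>n. measure M {\<omega> \<in> space M. hitting_time H X Y \<omega> > enat n}) \<longlonglongrightarrow> 0"
proof -
  have M: "prob_space M" and X: "\<And>n. X n \<in> borel_measurable M" and Y: "\<And>n. Y n \<in> borel_measurable M"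
    and fin: "AE \<omega> in M. hitting_time H X Y \<omega> < \<infinity>"
    using coupling unfolding successful_coupling_def marginally_markovian_coupling_def by auto
  interpret prob_space M by fact
  define T where "T n = {\<omega> \<in> space M. hitting_time H X Y \<omega> > enat n}" for n
  have "{\<omega> \<in> space M. hitting_time H X Y \<omega> \<le> enat n} \<in> sets M" for n
    by (rule hitting_time_le_measurable[OF H X Y])
  moreover have "T n = space M - {\<omega> \<in> space M. hitting_time H X Y \<omega> \<le> enat n}" for n
    by (auto simp: T_def)
  ultimately have T: "T n \<in> sets M" for n by auto
  have "decseq T"
    unfolding decseq_def T_def by (auto intro: order.strict_trans1[OF iffD2[OF enat_ord_simps(1)]])
  then have "(\<lambda>n. measure M (T n)) \<longlonglongrightarrow> measure M (\<Inter>n. T n)"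
    using T by (intro finite_Lim_measure_decseq) auto
  moreover have "measure M (\<Inter>n. T n) = 0"
  proof -
    have "AE \<omega> in M. \<omega> \<notin> (\<Inter>n. T n)"
      using fin
    proof eventually_elim
      case (elim \<omega>)
      then obtain n where "hitting_time H X Y \<omega> = enat n" by auto
      then have "\<omega> \<notin> T n" by (simp add: T_def)
      then show ?case by blast
    qed
    then show ?thesis using T by (subst prob_eq_0) auto
  qed
  ultimately show ?thesis unfolding T_def by simp
qed

lemma stationary_integral_kernel_op:
  fixes P :: "'a::{topological_space, order} \<Rightarrow> 'a measure"
  assumes P: "P \<in> borel \<rightarrow>\<^sub>M prob_algebra borel" and mono: "stochastically_monotone P"
    and \<pi>: "stationary_distribution P \<pi>" and g: "g \<in> increasing_functions"
  shows "(\<integral>x. (kernel_op P ^^ n) g x \<partial>\<pi>) = (\<integral>x. g x \<partial>\<pi>)"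
proof (induction n)
  case (Suc n)
  have "(\<integral>x. (kernel_op P ^^ Suc n) g x \<partial>\<pi>) = (\<integral>x. (kernel_op P ^^ n) g x \<partial>Giry_Monad.bind \<pi> P)"
    using bind_integral_increasing[OF P _ _ kernel_op_increasing[OF mono g], of \<pi>] \<pi>
    by (simp add: kernel_op_def stationary_distribution_def prob_space.finite_measure)
  with Suc \<pi> show ?case by (simp add: stationary_distribution_def)
qed simp

section \<open>Averaging over a stationary starting point\<close>

lemma increasing_functions_nonempty: "(increasing_functions :: ('a::{topological_space, order} \<Rightarrow> real) set) \<noteq> {}"
proof -
  have "(\<lambda>x::'a. 0) \<in> increasing_functions"
    by (auto simp: increasing_functions_def mono_def)
  then show ?thesis by blast
qed

text \<open>The bounds \<open>r y n\<close> need not be measurable in \<open>y\<close>, so they cannot be integrated. They are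
  used only pointwise, to see that the integrands for a fixed sequence of near-maximisers tend
  to zero.\<close>

lemma kernel_op_uniform_averaging:
  fixes P :: "'a::{topological_space, order} \<Rightarrow> 'a measure"
  assumes mono: "stochastically_monotone P" and \<pi>: "prob_space \<pi>" "sets \<pi> = sets borel"
    and r: "\<And>y. r y \<longlonglongrightarrow> 0"
    and bound: "\<And>g n y. g \<in> increasing_functions \<Longrightarrow> \<bar>(kernel_op P ^^ n) g x - (kernel_op P ^^ n) g y\<bar> \<le> r y n"
  shows "(\<lambda>n. SUP g\<in>increasing_functions.
      \<integral>y. \<bar>(kernel_op P ^^ n) g x - (kernel_op P ^^ n) g y\<bar> \<partial>\<pi>) \<longlonglongrightarrow> 0"
    and "g \<in> increasing_functions \<Longrightarrow> (\<integral>y. \<bar>(kernel_op P ^^ n) g x - (kernel_op P ^^ n) g y\<bar> \<partial>\<pi>)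
      \<le> (SUP g\<in>increasing_functions. \<integral>y. \<bar>(kernel_op P ^^ n) g x - (kernel_op P ^^ n) g y\<bar> \<partial>\<pi>)"
proof -
  interpret prob_space \<pi> by fact
  define d where "d n g y = \<bar>(kernel_op P ^^ n) g x - (kernel_op P ^^ n) g y\<bar>" for n g y
  define b where "b n = (SUP g\<in>increasing_functions. \<integral>y. d n g y \<partial>\<pi>)" for n
  have d: "0 \<le> d n g y" "d n g y \<le> 1" "d n g \<in> borel_measurable \<pi>"
    if "g \<in> increasing_functions" for n g y
  proof -
    note p = increasing_functionsD[OF kernel_op_increasing[OF mono that, of n]]
    show "0 \<le> d n g y" by (simp add: d_def)
    show "d n g y \<le> 1" using p(3,4)[of x] p(3,4)[of y] unfolding d_def by linarith
    have "(kernel_op P ^^ n) g \<in> borel_measurable \<pi>"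
      using p(1) \<pi>(2) by (simp cong: measurable_cong_sets)
    then show "d n g \<in> borel_measurable \<pi>" unfolding d_def by measurable
  qed
  have le1: "(\<integral>y. d n g y \<partial>\<pi>) \<le> 1" if "g \<in> increasing_functions" for n g
    by (rule integral_le_const)
      (use d[OF that] in \<open>auto intro!: integrable_const_bound[of _ 1]\<close>)
  have bdd: "bdd_above ((\<lambda>g. \<integral>y. d n g y \<partial>\<pi>) ` increasing_functions)" for n
    using le1 by (intro bdd_aboveI2)
  have upper: "(\<integral>y. d n g y \<partial>\<pi>) \<le> b n" if "g \<in> increasing_functions" for n g
    unfolding b_def by (rule cSUP_upper[OF that bdd])
  then show "g \<in> increasing_functions \<Longrightarrow> (\<integral>y. \<bar>(kernel_op P ^^ n) g x - (kernel_op P ^^ n) g y\<bar> \<partial>\<pi>)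
      \<le> (SUP g\<in>increasing_functions. \<integral>y. \<bar>(kernel_op P ^^ n) g x - (kernel_op P ^^ n) g y\<bar> \<partial>\<pi>)"
    unfolding b_def d_def .
  have "\<exists>g\<in>increasing_functions. b n - 1 / Suc n < (\<integral>y. d n g y \<partial>\<pi>)" for n
    unfolding b_def
    by (subst less_cSUP_iff[OF increasing_functions_nonempty bdd, symmetric]) simp
  \<comment> \<open>Near-maximisers: the supremum over all \<open>g\<close> is replaced by one sequence of functions.\<close>
  then obtain G where G: "\<And>n. G n \<in> increasing_functions"
    "\<And>n. b n - 1 / Suc n < (\<integral>y. d n (G n) y \<partial>\<pi>)"
    by metis
  have "(\<lambda>n. \<integral>y. d n (G n) y \<partial>\<pi>) \<longlonglongrightarrow> (\<integral>y. 0 \<partial>\<pi>)"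
  proof (rule integral_dominated_convergence[where w = "\<lambda>_. 1"])
    show "AE y in \<pi>. (\<lambda>n. d n (G n) y) \<longlonglongrightarrow> 0"
    proof (rule AE_I2)
      fix y
      show "(\<lambda>n. d n (G n) y) \<longlonglongrightarrow> 0"
        by (rule tendsto_sandwich[OF _ _ tendsto_const r[of y]])
          (use d(1)[OF G(1)] bound[OF G(1)] in \<open>auto simp: d_def\<close>)
    qed
    show "AE y in \<pi>. norm (d n (G n) y) \<le> 1" for n
      using d(1,2)[OF G(1)] by (intro AE_I2) simp
  qed (use d(3)[OF G(1)] in auto)
  then have upper_lim: "(\<lambda>n. (\<integral>y. d n (G n) y \<partial>\<pi>) + 1 / Suc n) \<longlonglongrightarrow> 0"
    using tendsto_add[OF _ LIMSEQ_inverse_real_of_nat] by (fastforce simp: inverse_eq_divide)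
  have "0 \<le> b n" for n
  proof -
    have "0 \<le> (\<integral>y. d n (G n) y \<partial>\<pi>)"
      using d(1)[OF G(1)] by simp
    then show ?thesis using upper[OF G(1), of n n] by linarith
  qed
  moreover have "b n \<le> (\<integral>y. d n (G n) y \<partial>\<pi>) + 1 / Suc n" for n
    using G(2)[of n] by simp
  ultimately have "b \<longlonglongrightarrow> 0"
    by (intro tendsto_sandwich[OF _ _ tendsto_const upper_lim] always_eventually allI)
  then show "(\<lambda>n. SUP g\<in>increasing_functions.
      \<integral>y. \<bar>(kernel_op P ^^ n) g x - (kernel_op P ^^ n) g y\<bar> \<partial>\<pi>) \<longlonglongrightarrow> 0"
    unfolding b_def d_def .
qed

text \<open>By stationarity \<open>\<integral> g d\<pi> = \<integral> P\<^sup>ng d\<pi>\<close>, so the difference on the left is itself an average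
  over \<open>y\<close>.\<close>

lemma kernel_op_stationary_distance_le:
  fixes P :: "'a::{topological_space, order} \<Rightarrow> 'a measure"
  assumes P: "P \<in> borel \<rightarrow>\<^sub>M prob_algebra borel" and mono: "stochastically_monotone P"
    and \<pi>: "stationary_distribution P \<pi>"
    and g: "g \<in> increasing_functions"
  shows "\<bar>(kernel_op P ^^ n) g x - (\<integral>y. g y \<partial>\<pi>)\<bar> \<le> (\<integral>y. \<bar>(kernel_op P ^^ n) g x - (kernel_op P ^^ n) g y\<bar> \<partial>\<pi>)"
proof -
  have \<pi>': "prob_space \<pi>" "sets \<pi> = sets borel"
    using \<pi> unfolding stationary_distribution_def by auto
  interpret prob_space \<pi> by fact
  have "integrable \<pi> ((kernel_op P ^^ n) g)"
    using integrable_increasing[OF \<pi>'(1) _ kernel_op_increasing[OF mono g], of "\<lambda>y. y"]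
      measurable_ident_sets[OF \<pi>'(2)] by simp
  then have "(kernel_op P ^^ n) g x - (\<integral>y. g y \<partial>\<pi>)
      = (\<integral>y. (kernel_op P ^^ n) g x - (kernel_op P ^^ n) g y \<partial>\<pi>)"
    using stationary_integral_kernel_op[OF P mono \<pi> g, of n] prob_space by simp
  then show ?thesis by (simp add: integral_abs_bound)
qed


section \<open>The span of the increasing functions\<close>

text \<open>Convergence of integrals passes from increasing functions to these functions by linearity
  alone.\<close>

inductive_set increasing_span :: "('a::{topological_space, order} \<Rightarrow> real) set" where
  base: "g \<in> increasing_functions \<Longrightarrow> g \<in> increasing_span"
| add: "f \<in> increasing_span \<Longrightarrow> g \<in> increasing_span \<Longrightarrow> (\<lambda>x. f x + g x) \<in> increasing_span"
| scale: "f \<in> increasing_span \<Longrightarrow> (\<lambda>x. c * f x) \<in> increasing_span"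

lemma increasing_span_const: "(\<lambda>x. c) \<in> increasing_span"
proof -
  have "(\<lambda>x::'a. 1) \<in> increasing_functions"
    by (auto simp: increasing_functions_def mono_def)
  from increasing_span.scale[OF increasing_span.base[OF this], of c] show ?thesis by simp
qed

text \<open>Increasing functions with values in \<open>[0, 1]\<close> are closed under products, so their span is an
  algebra. The sets whose indicators lie in the span therefore form an algebra of sets.\<close>

lemma increasing_span_mult:
  assumes "f \<in> increasing_span" "g \<in> increasing_span"
  shows "(\<lambda>x. f x * g x) \<in> increasing_span"
  using assms(1)
proof induction
  case (base f)
  from assms(2) show ?case
  proof induction
    case (base g)
    with \<open>f \<in> increasing_functions\<close> have "(\<lambda>x. f x * g x) \<in> increasing_functions"
      by (auto simp: increasing_functions_def mono_def intro!: mult_mono mult_le_one)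
    then show ?case by (rule increasing_span.base)
  next
    case (add g h)
    then show ?case using increasing_span.add[OF add.IH] by (simp add: algebra_simps)
  next
    case (scale g c)
    then show ?case using increasing_span.scale[OF scale.IH, of c] by (simp add: algebra_simps)
  qed
next
  case (add f h)
  then show ?case using increasing_span.add[OF add.IH] by (simp add: algebra_simps)
next
  case (scale f c)
  then show ?case using increasing_span.scale[OF scale.IH, of c] by (simp add: algebra_simps)
qed

lemma increasing_span_diff:
  assumes "f \<in> increasing_span" "g \<in> increasing_span"
  shows "(\<lambda>x. f x - g x) \<in> increasing_span"
  using increasing_span.add[OF assms(1) increasing_span.scale[OF assms(2), of "-1"]] by simp

lemma increasing_span_sum:
  assumes "\<And>i. i \<in> I \<Longrightarrow> f i \<in> increasing_span"
  shows "(\<lambda>x. \<Sum>i\<in>I. f i x) \<in> increasing_span"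
  using assms
  by (induction I rule: infinite_finite_induct)
    (auto simp: increasing_span_const intro: increasing_span.add)

lemma increasing_span_measurable:
  assumes "f \<in> increasing_span"
  shows "f \<in> borel_measurable borel"
  using assms by induction (auto simp: increasing_functions_def)

lemma increasing_span_bounded:
  assumes "f \<in> increasing_span"
  shows "\<exists>B. \<forall>x. \<bar>f x\<bar> \<le> B"
  using assms
proof induction
  case (base g)
  then show ?case by (auto simp: increasing_functions_def intro!: exI[of _ 1])
next
  case (add f g)
  then obtain B C where "\<bar>f x\<bar> \<le> B" "\<bar>g x\<bar> \<le> C" for x by blast
  then show ?case by (intro exI[of _ "B + C"] allI order_trans[OF abs_triangle_ineq] add_mono)
next
  case (scale f c)
  then obtain B where "\<bar>f x\<bar> \<le> B" for x by blast
  then show ?case by (intro exI[of _ "\<bar>c\<bar> * B"]) (auto simp: abs_mult intro!: mult_left_mono)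
qed

lemma indicator_span_compl:
  assumes "(indicator T :: _ \<Rightarrow> real) \<in> increasing_span"
  shows "(indicator (- T) :: _ \<Rightarrow> real) \<in> increasing_span"
proof -
  have "(indicator (- T) :: _ \<Rightarrow> real) = (\<lambda>x. 1 - indicator T x)"
    by (auto split: split_indicator)
  then show ?thesis using increasing_span_diff[OF increasing_span_const assms] by simp
qed

lemma indicator_span_Int:
  assumes "(indicator S :: _ \<Rightarrow> real) \<in> increasing_span" "(indicator T :: _ \<Rightarrow> real) \<in> increasing_span"
  shows "(indicator (S \<inter> T) :: _ \<Rightarrow> real) \<in> increasing_span"
  using increasing_span_mult[OF assms] by (simp add: indicator_inter_arith[abs_def])

lemma indicator_span_INT:
  assumes "finite I" "\<And>i. i \<in> I \<Longrightarrow> (indicator (S i) :: _ \<Rightarrow> real) \<in> increasing_span"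
  shows "(indicator (\<Inter>i\<in>I. S i) :: _ \<Rightarrow> real) \<in> increasing_span"
  using assms by (induction I)
    (auto simp: indicator_span_Int indicator_def increasing_span_const simp del: indicator_span_Int
      intro: indicator_span_Int)

lemma indicator_span_UN:
  assumes "finite I" "\<And>i. i \<in> I \<Longrightarrow> (indicator (S i) :: _ \<Rightarrow> real) \<in> increasing_span"
  shows "(indicator (\<Union>i\<in>I. S i) :: _ \<Rightarrow> real) \<in> increasing_span"
  using indicator_span_compl[OF indicator_span_INT[OF assms(1), of "\<lambda>i. - S i"]]
    indicator_span_compl[OF assms(2)] by (simp add: Compl_INT)

text \<open>By compactness of \<open>K\<close>, points of \<open>K\<close> below a convergent sequence have a convergent
  subsequence, and the closed order passes to the limit.\<close>

lemma increasing_hull_closed: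
  fixes K :: "'a::{polish_space, order} set"
  assumes M: "closed (order_graph :: ('a \<times> 'a) set)" and K: "compact K"
  shows "closed (increasing_hull K)"
proof (unfold closed_sequential_limits, intro allI impI, elim conjE)
  fix x l assume "\<forall>n. x n \<in> increasing_hull K" and x: "x \<longlonglongrightarrow> l"
  then obtain y where y: "\<And>n. y n \<in> K" "\<And>n. y n \<le> x n"
    unfolding increasing_hull_def by simp metis
  obtain a r where a: "a \<in> K" "strict_mono r" "(y \<circ> r) \<longlonglongrightarrow> a"
    using compact_imp_seq_compact[OF K] y(1) unfolding seq_compact_def by metis
  have lim: "(\<lambda>n. (y (r n), x (r n))) \<longlonglongrightarrow> (a, l)"
    using a(3) LIMSEQ_subseq_LIMSEQ[OF x a(2)] by (intro tendsto_Pair) (auto simp: o_def)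
  have mem: "(y (r n), x (r n)) \<in> order_graph" for n
    using y(2) by (simp add: order_graph_def)
  have "(a, l) \<in> order_graph"
    by (rule closed_sequentially[OF M mem lim])
  then show "l \<in> increasing_hull K"
    using a(1) by (auto simp: increasing_hull_def order_graph_def)
qed

lemma decreasing_hull_closed:
  fixes K :: "'a::{polish_space, order} set"
  assumes M: "closed (order_graph :: ('a \<times> 'a) set)" and K: "compact K"
  shows "closed (decreasing_hull K)"
proof (unfold closed_sequential_limits, intro allI impI, elim conjE)
  fix x l assume "\<forall>n. x n \<in> decreasing_hull K" and x: "x \<longlonglongrightarrow> l"
  then obtain y where y: "\<And>n. y n \<in> K" "\<And>n. x n \<le> y n"
    unfolding decreasing_hull_def by simp metis
  obtain a r where a: "a \<in> K" "strict_mono r" "(y \<circ> r) \<longlonglongrightarrow> a"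
    using compact_imp_seq_compact[OF K] y(1) unfolding seq_compact_def by metis
  have lim: "(\<lambda>n. (x (r n), y (r n))) \<longlonglongrightarrow> (l, a)"
    using a(3) LIMSEQ_subseq_LIMSEQ[OF x a(2)] by (intro tendsto_Pair) (auto simp: o_def)
  have mem: "(x (r n), y (r n)) \<in> order_graph" for n
    using y(2) by (simp add: order_graph_def)
  have "(l, a) \<in> order_graph"
    by (rule closed_sequentially[OF M mem lim])
  then show "l \<in> decreasing_hull K"
    using a(1) by (auto simp: decreasing_hull_def order_graph_def)
qed

lemma indicator_increasing_hull:
  fixes K :: "'a::{polish_space, order} set"
  assumes "closed (order_graph :: ('a \<times> 'a) set)" "compact K"
  shows "(indicator (increasing_hull K) :: 'a \<Rightarrow> real) \<in> increasing_functions"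
  using increasing_hull_closed[OF assms]
  by (auto simp: increasing_functions_def mono_def increasing_hull_def
      split: split_indicator intro: order_trans)

lemma indicator_decreasing_hull:
  fixes K :: "'a::{polish_space, order} set"
  assumes "closed (order_graph :: ('a \<times> 'a) set)" "compact K"
  shows "(indicator (- decreasing_hull K) :: 'a \<Rightarrow> real) \<in> increasing_functions"
  using decreasing_hull_closed[OF assms]
  by (auto simp: increasing_functions_def mono_def decreasing_hull_def
      split: split_indicator intro: order_trans)

section \<open>Approximation of continuous functions on compact sets\<close>

text \<open>By antisymmetry \<open>c \<le> d\<close> or \<open>d \<le> c\<close> fails, and since the order is closed it then fails for
  all pairs near \<open>(c, d)\<close>. The separating set is the increasing or decreasing hull of a closed
  ball around \<open>c\<close>; the intersection of the ball with \<open>K\<close> makes it compact, so that its hull is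
  closed and in particular measurable.\<close>

lemma separating_neighbourhoods:
  fixes c d :: "'a::{polish_space, order}"
  assumes M: "closed (order_graph :: ('a \<times> 'a) set)" and K: "compact K" and "c \<noteq> d"
  obtains T U V where "(indicator T :: 'a \<Rightarrow> real) \<in> increasing_span"
    "open U" "open V" "c \<in> U" "d \<in> V" "U \<inter> K \<subseteq> T" "T \<inter> V = {}"
proof -
  have op: "open (- order_graph :: ('a \<times> 'a) set)"
    using M by (simp add: open_Compl)
  from \<open>c \<noteq> d\<close> consider "\<not> c \<le> d" | "\<not> d \<le> c" by fastforce
  then show thesis
  proof cases
    case 1
    then have "(c, d) \<in> - order_graph" by (simp add: order_graph_def)
    then obtain U V where UV: "open U" "open V" "(c, d) \<in> U \<times> V" "U \<times> V \<subseteq> - order_graph"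
      using open_prod_elim[OF op] by blast
    then obtain e where e: "e > 0" "cball c e \<subseteq> U"
      using open_contains_cball by (metis SigmaD1)
    let ?T = "increasing_hull (cball c e \<inter> K)"
    have "(indicator ?T :: 'a \<Rightarrow> real) \<in> increasing_span"
      by (intro increasing_span.base indicator_increasing_hull[OF M] closed_Int_compact K) simp
    moreover have "ball c e \<inter> K \<subseteq> ?T"
      by (auto simp: increasing_hull_def)
    moreover have "?T \<inter> V = {}"
      using UV(4) e(2) by (force simp: increasing_hull_def order_graph_def)
    ultimately show thesis
      using that[of ?T "ball c e" V] UV e by auto
  next
    case 2
    then have "(d, c) \<in> - order_graph" by (simp add: order_graph_def)
    then obtain V U where UV: "open V" "open U" "(d, c) \<in> V \<times> U" "V \<times> U \<subseteq> - order_graph"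
      using open_prod_elim[OF op] by blast
    then obtain e where e: "e > 0" "cball c e \<subseteq> U"
      using open_contains_cball by (metis SigmaD2)
    let ?T = "decreasing_hull (cball c e \<inter> K)"
    have "(indicator (- ?T) :: 'a \<Rightarrow> real) \<in> increasing_span"
      by (intro increasing_span.base indicator_decreasing_hull[OF M] closed_Int_compact K) simp
    from indicator_span_compl[OF this] have "(indicator ?T :: 'a \<Rightarrow> real) \<in> increasing_span"
      by simp
    moreover have "ball c e \<inter> K \<subseteq> ?T"
      by (auto simp: decreasing_hull_def)
    moreover have "?T \<inter> V = {}"
      using UV(4) e(2) by (force simp: decreasing_hull_def order_graph_def)
    ultimately show thesis
      using that[of ?T "ball c e" V] UV e by auto
  qed
qed

text \<open>The usual two-step compactness argument, first for a point of \<open>C\<close> against all of \<open>D\<close> and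
  then for all of \<open>C\<close>; it only uses finite unions and intersections of separating sets, which
  stay in the algebra.\<close>

lemma span_separates_compacts:
  fixes K C D :: "'a::{polish_space, order} set"
  assumes M: "closed (order_graph :: ('a \<times> 'a) set)"
    and K: "compact K" and C: "compact C" "C \<subseteq> K" and D: "compact D" and disj: "C \<inter> D = {}"
  obtains T where "(indicator T :: 'a \<Rightarrow> real) \<in> increasing_span" "C \<subseteq> T" "T \<inter> D = {}"
proof -
  have point: "\<exists>T U. (indicator T :: 'a \<Rightarrow> real) \<in> increasing_span \<and> open U \<and> c \<in> U
      \<and> U \<inter> K \<subseteq> T \<and> T \<inter> D = {}" if "c \<in> C" for c
  proof -
    have "\<exists>T U V. (indicator T :: 'a \<Rightarrow> real) \<in> increasing_span \<and>
      open U \<and> open V \<and> c \<in> U \<and> d \<in> V \<and> U \<inter> K \<subseteq> T \<and> T \<inter> V = {}" if "d \<in> D" for d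
    proof -
      have "c \<noteq> d" using \<open>c \<in> C\<close> \<open>d \<in> D\<close> disj by auto
      from separating_neighbourhoods[OF M K this] show ?thesis by metis
    qed
    then have "\<forall>d\<in>D. \<exists>T U V. (indicator T :: 'a \<Rightarrow> real) \<in> increasing_span \<and>
      open U \<and> open V \<and> c \<in> U \<and> d \<in> V \<and> U \<inter> K \<subseteq> T \<and> T \<inter> V = {}" by blast
    then obtain T U V where TUV:
      "\<And>d. d \<in> D \<Longrightarrow> (indicator (T d) :: 'a \<Rightarrow> real) \<in> increasing_span"
      "\<And>d. d \<in> D \<Longrightarrow> open (U d)" "\<And>d. d \<in> D \<Longrightarrow> open (V d)" "\<And>d. d \<in> D \<Longrightarrow> c \<in> U d"
      "\<And>d. d \<in> D \<Longrightarrow> d \<in> V d" "\<And>d. d \<in> D \<Longrightarrow> U d \<inter> K \<subseteq> T d" "\<And>d. d \<in> D \<Longrightarrow> T d \<inter> V d = {}"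
      unfolding bchoice_iff by blast
    obtain D' where D': "D' \<subseteq> D" "finite D'" "D \<subseteq> (\<Union>d\<in>D'. V d)"
      by (rule compactE_image[OF D, of D V]) (use TUV in auto)
    show ?thesis
    proof (intro exI conjI)
      show "(indicator (\<Inter>d\<in>D'. T d) :: 'a \<Rightarrow> real) \<in> increasing_span"
        using D' TUV(1) by (intro indicator_span_INT) auto
      show "open (\<Inter>d\<in>D'. U d)" using D' TUV(2) by (intro open_INT) auto
      show "c \<in> (\<Inter>d\<in>D'. U d)" using D' TUV(4) by auto
      show "(\<Inter>d\<in>D'. U d) \<inter> K \<subseteq> (\<Inter>d\<in>D'. T d)" using D'(1) TUV(6) by blast
      show "(\<Inter>d\<in>D'. T d) \<inter> D = {}" using D'(1,3) TUV(7) by blast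
    qed
  qed
  then obtain T U where TU:
    "\<And>c. c \<in> C \<Longrightarrow> (indicator (T c) :: 'a \<Rightarrow> real) \<in> increasing_span"
    "\<And>c. c \<in> C \<Longrightarrow> open (U c)" "\<And>c. c \<in> C \<Longrightarrow> c \<in> U c"
    "\<And>c. c \<in> C \<Longrightarrow> U c \<inter> K \<subseteq> T c" "\<And>c. c \<in> C \<Longrightarrow> T c \<inter> D = {}"
    by metis
  obtain C' where C': "C' \<subseteq> C" "finite C'" "C \<subseteq> (\<Union>c\<in>C'. U c)"
    by (rule compactE_image[OF C(1), of C U]) (use TU in auto)
  show thesis
  proof (rule that)
    show "(indicator (\<Union>c\<in>C'. T c) :: 'a \<Rightarrow> real) \<in> increasing_span"
      using C' TU(1) by (intro indicator_span_UN) auto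
    show "C \<subseteq> (\<Union>c\<in>C'. T c)" using C'(1,3) TU(4) C(2) by blast
    show "(\<Union>c\<in>C'. T c) \<inter> D = {}" using C'(1) TU(5) by blast
  qed
qed

text \<open>The function \<open>h\<close> counts, in units of \<open>1 / m\<close>, how many levels \<open>f\<close> passes: the set \<open>T j\<close>
  separates \<open>{f \<ge> (j + 1) / m}\<close> from \<open>{f \<le> j / m}\<close> inside \<open>K\<close>. Values between two consecutive
  levels cost an error of at most one unit. The bounds \<open>0 \<le> h \<le> 1\<close> hold everywhere, also
  outside \<open>K\<close>, where \<open>h\<close> is otherwise uncontrolled.\<close>

lemma span_approximates_continuous:
  fixes f :: "'a::{polish_space, order} \<Rightarrow> real"
  assumes M: "closed (order_graph :: ('a \<times> 'a) set)" and K: "compact K"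
    and f: "continuous_on UNIV f" "\<And>x. 0 \<le> f x" "\<And>x. f x \<le> 1" and m: "m > (0::nat)"
  obtains h where "h \<in> increasing_span" "\<And>x. 0 \<le> h x" "\<And>x. h x \<le> 1"
    "\<And>x. x \<in> K \<Longrightarrow> \<bar>f x - h x\<bar> \<le> 1 / m"
proof -
  have levels: "\<exists>T. (indicator T :: 'a \<Rightarrow> real) \<in> increasing_span \<and>
      {x. Suc j \<le> m * f x} \<inter> K \<subseteq> T \<and> T \<inter> ({x. m * f x \<le> j} \<inter> K) = {}" for j :: nat
  proof -
    have 1: "compact ({x. Suc j \<le> m * f x} \<inter> K)"
      by (intro closed_Int_compact K closed_Collect_le continuous_intros f)
    have 2: "compact ({x. m * f x \<le> j} \<inter> K)"
      by (intro closed_Int_compact K closed_Collect_le continuous_intros f)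
    show ?thesis
      by (rule span_separates_compacts[OF M K 1 _ 2]) auto
  qed
  obtain T where T: "\<And>j::nat. (indicator (T j) :: 'a \<Rightarrow> real) \<in> increasing_span"
    "\<And>(j::nat) x. Suc j \<le> m * f x \<Longrightarrow> x \<in> K \<Longrightarrow> x \<in> T j"
    "\<And>(j::nat) x. m * f x \<le> j \<Longrightarrow> x \<in> K \<Longrightarrow> x \<notin> T j"
  proof atomize_elim
    have "\<forall>j. \<exists>T. (indicator T :: 'a \<Rightarrow> real) \<in> increasing_span \<and>
        {x. Suc j \<le> m * f x} \<inter> K \<subseteq> T \<and> T \<inter> ({x. m * f x \<le> j} \<inter> K) = {}"
      using levels by blast
    from choice[OF this] show "\<exists>T. (\<forall>j. (indicator (T j) :: 'a \<Rightarrow> real) \<in> increasing_span) \<and>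
        (\<forall>(j::nat) x. Suc j \<le> m * f x \<longrightarrow> x \<in> K \<longrightarrow> x \<in> T j) \<and>
        (\<forall>(j::nat) x. m * f x \<le> j \<longrightarrow> x \<in> K \<longrightarrow> x \<notin> T j)"
      by (rule ex_forward) blast
  qed
  define S where "S x = {j. j < m \<and> x \<in> T j}" for x
  have S: "finite (S x)" for x by (simp add: S_def)
  define h where "h = (\<lambda>x. (1 / m) * (\<Sum>j\<in>{..<m}. indicator (T j) x))"
  have h: "h x = card (S x) / m" for x
  proof -
    have "(\<Sum>j\<in>{..<m}. indicator (T j) x :: real) = (\<Sum>j\<in>S x. 1)"
      unfolding S_def by (intro sum.mono_neutral_cong_right) auto
    then show ?thesis by (simp add: h_def)
  qed
  show thesis
  proof (rule that)
    show "h \<in> increasing_span"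
      unfolding h_def by (intro increasing_span.scale increasing_span_sum T)
    show "0 \<le> h x" for x by (simp add: h)
    show "h x \<le> 1" for x
      using card_mono[of "{..<m}" "S x"] m by (auto simp: h S_def)
    fix x assume x: "x \<in> K"
    \<comment> \<open>Levels below \<open>k\<close> are certainly counted at \<open>x\<close>, and levels above \<open>k\<close> are not.\<close>
    define k where "k = nat \<lfloor>m * f x\<rfloor>"
    have k: "real k \<le> m * f x" "m * f x < real k + 1"
      using f(2)[of x] by (auto simp: k_def)
    have "k \<le> m" using k(1) mult_left_mono[OF f(3)[of x], of "real m"] by simp
    have "{..<k} \<subseteq> S x"
      using k(1) \<open>k \<le> m\<close> x by (auto simp: S_def intro!: T(2))
    from card_mono[OF S this] have "k \<le> card (S x)" by simp
    have "S x \<subseteq> {..k}"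
      using k(2) T(3)[OF _ x] by (force simp: S_def not_le[symmetric])
    from card_mono[OF _ this] have "card (S x) \<le> Suc k" by simp
    with \<open>k \<le> card (S x)\<close> k have "\<bar>m * f x - card (S x)\<bar> \<le> 1" by linarith
    moreover have "f x - h x = (m * f x - card (S x)) / m"
      using m by (simp add: h field_simps)
    ultimately show "\<bar>f x - h x\<bar> \<le> 1 / m"
      using m by (simp add: divide_right_mono)
  qed
qed

section \<open>From increasing functions to weak convergence\<close>

lemma prob_inner_compact:
  fixes \<nu> :: "'a::polish_space measure"
  assumes "prob_space \<nu>" "sets \<nu> = sets borel" "\<epsilon> > 0"
  obtains K where "compact K" "measure \<nu> K > 1 - \<epsilon>"
proof -
  interpret prob_space \<nu> by fact
  have sp: "space \<nu> = UNIV" using sets_eq_imp_space_eq[OF assms(2)] by simp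
  have "(SUP K\<in>{K. K \<subseteq> UNIV \<and> compact K}. emeasure \<nu> K) = 1"
    using inner_regular[OF assms(2), of UNIV] emeasure_space_1 by (simp add: sp)
  then have "ennreal (1 - \<epsilon>) < (SUP K\<in>{K. K \<subseteq> UNIV \<and> compact K}. emeasure \<nu> K)"
    using assms(3) by (simp add: ennreal_less_one_iff)
  then obtain K where "compact K" "ennreal (1 - \<epsilon>) < emeasure \<nu> K"
    by (auto simp: less_SUP_iff)
  then show thesis
    using that[of K] measure_nonneg[of \<nu> K]
    by (cases "1 - \<epsilon> \<ge> 0") (simp_all add: emeasure_eq_measure ennreal_less_iff)
qed

lemma prob_compact_mono:
  fixes \<nu> :: "'a::polish_space measure"
  assumes "prob_space \<nu>" "sets \<nu> = sets borel" "compact K" "C \<subseteq> K"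
  shows "measure \<nu> C \<le> measure \<nu> K"
proof -
  interpret prob_space \<nu> by fact
  show ?thesis
    using assms by (intro finite_measure_mono) (simp_all add: borel_compact)
qed

lemma integral_diff_le_compact:
  fixes f h :: "'a::polish_space \<Rightarrow> real"
  assumes \<rho>: "prob_space \<rho>" "sets \<rho> = sets borel"
    and f: "f \<in> borel_measurable borel" "\<And>x. 0 \<le> f x" "\<And>x. f x \<le> 1"
    and h: "h \<in> borel_measurable borel" "\<And>x. 0 \<le> h x" "\<And>x. h x \<le> 1"
    and K: "compact K" "measure \<rho> K > 1 - \<epsilon>" and close: "\<And>x. x \<in> K \<Longrightarrow> \<bar>f x - h x\<bar> \<le> \<delta>"
    and "\<delta> \<ge> 0"
  shows "\<bar>(\<integral>x. f x \<partial>\<rho>) - (\<integral>x. h x \<partial>\<rho>)\<bar> \<le> \<delta> + \<epsilon>"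
proof -
  interpret prob_space \<rho> by fact
  have sp: "space \<rho> = UNIV" using sets_eq_imp_space_eq[OF assms(2)] by simp
  have [measurable]: "f \<in> borel_measurable \<rho>" "h \<in> borel_measurable \<rho>"
    using f(1) h(1) \<rho>(2) by (simp_all cong: measurable_cong_sets)
  have [measurable]: "K \<in> sets \<rho>" using K(1) \<rho>(2) by (simp add: borel_compact)
  have int: "integrable \<rho> f" "integrable \<rho> h" "integrable \<rho> (indicator (UNIV - K) :: 'a \<Rightarrow> real)"
    using sp f h by (auto intro!: integrable_const_bound[of _ 1] split: split_indicator)
  have "\<bar>(\<integral>x. f x \<partial>\<rho>) - (\<integral>x. h x \<partial>\<rho>)\<bar> = \<bar>\<integral>x. f x - h x \<partial>\<rho>\<bar>"
    using int by simp
  also have "\<dots> \<le> (\<integral>x. \<bar>f x - h x\<bar> \<partial>\<rho>)"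
    by (rule integral_abs_bound)
  also have "\<dots> \<le> (\<integral>x. \<delta> + indicator (- K) x \<partial>\<rho>)"
  proof (rule integral_mono)
    show "integrable \<rho> (\<lambda>x. \<delta> + indicator (- K) x)"
      using int(3) by (simp add: Compl_eq_Diff_UNIV)
    fix x
    show "\<bar>f x - h x\<bar> \<le> \<delta> + indicator (- K) x"
      using close[of x] f(2,3)[of x] h(2,3)[of x] \<open>\<delta> \<ge> 0\<close> by (cases "x \<in> K") auto
  qed (use int in auto)
  also have "\<dots> = \<delta> + measure \<rho> (space \<rho> - K)"
    using int(3) sp prob_space by (simp add: Compl_eq_Diff_UNIV)
  also have "\<dots> \<le> \<delta> + \<epsilon>"
    using K(2) by (subst prob_compl) auto
  finally show ?thesis .
qed

lemma increasing_span_integral_tendsto: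
  fixes \<mu> :: "nat \<Rightarrow> 'a::{polish_space, order} measure"
  assumes \<mu>: "\<And>n. prob_space (\<mu> n)" "\<And>n. sets (\<mu> n) = sets borel"
    and \<nu>: "prob_space \<nu>" "sets \<nu> = sets borel"
    and lim: "\<And>g. g \<in> increasing_functions \<Longrightarrow> (\<lambda>n. \<integral>x. g x \<partial>\<mu> n) \<longlonglongrightarrow> (\<integral>x. g x \<partial>\<nu>)"
    and h: "h \<in> increasing_span"
  shows "(\<lambda>n. \<integral>x. h x \<partial>\<mu> n) \<longlonglongrightarrow> (\<integral>x. h x \<partial>\<nu>)"
proof -
  have int: "integrable \<rho> f"
    if \<rho>: "prob_space \<rho>" "sets \<rho> = sets borel" and f: "f \<in> increasing_span" for f :: "'a \<Rightarrow> real" and \<rho>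
  proof -
    interpret prob_space \<rho> by fact
    obtain B where "\<And>x. \<bar>f x\<bar> \<le> B" using increasing_span_bounded[OF f] by blast
    moreover have "f \<in> borel_measurable \<rho>"
      using increasing_span_measurable[OF f] \<rho>(2) by (simp cong: measurable_cong_sets)
    ultimately show ?thesis by (intro integrable_const_bound[of _ B]) auto
  qed
  from h show ?thesis
    by induction (use lim \<mu> \<nu> int in \<open>auto intro!: tendsto_intros\<close>)
qed

text \<open>Replacing \<open>f\<close> by its approximation \<open>h\<close> on a compact set of mass above \<open>1 - \<epsilon>\<close> costs at most
  \<open>2\<epsilon>\<close> for each measure, and the integrals of \<open>h\<close> converge.\<close>

lemma weak_convergence_if_tight:
  fixes \<mu> :: "nat \<Rightarrow> 'a::{polish_space, order} measure"
  assumes M: "closed (order_graph :: ('a \<times> 'a) set)"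
    and \<mu>: "\<And>n. prob_space (\<mu> n)" "\<And>n. sets (\<mu> n) = sets borel"
    and \<nu>: "prob_space \<nu>" "sets \<nu> = sets borel"
    and tight: "tight_sequence \<mu>"
    and lim: "\<And>g. g \<in> increasing_functions \<Longrightarrow> (\<lambda>n. \<integral>x. g x \<partial>\<mu> n) \<longlonglongrightarrow> (\<integral>x. g x \<partial>\<nu>)"
  shows "converges_weakly \<mu> \<nu>"
proof -
  have unit: "(\<lambda>n. \<integral>x. f x \<partial>\<mu> n) \<longlonglongrightarrow> (\<integral>x. f x \<partial>\<nu>)"
    if f: "continuous_on UNIV f" "\<And>x. 0 \<le> f x" "\<And>x. f x \<le> 1" for f :: "'a \<Rightarrow> real"
  proof (rule LIMSEQ_I)
    fix r :: real assume "r > 0"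
    \<comment> \<open>Twice \<open>2\<epsilon>\<close> for replacing \<open>f\<close> by \<open>h\<close>, and \<open>\<epsilon>\<close> for the convergence of the integrals of \<open>h\<close>.\<close>
    define \<epsilon> where "\<epsilon> = r / 5"
    have "\<epsilon> > 0" using \<open>r > 0\<close> by (simp add: \<epsilon>_def)
    obtain K1 where K1: "compact K1" "\<And>n. measure (\<mu> n) K1 > 1 - \<epsilon>"
      using tight \<open>\<epsilon> > 0\<close> unfolding tight_sequence_def by blast
    obtain K2 where K2: "compact K2" "measure \<nu> K2 > 1 - \<epsilon>"
      using prob_inner_compact[OF \<nu> \<open>\<epsilon> > 0\<close>] .
    define K where "K = K1 \<union> K2"
    have K: "compact K" using K1 K2 by (simp add: K_def compact_Un)
    have \<mu>K: "measure (\<mu> n) K > 1 - \<epsilon>" for n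
    proof -
      have "measure (\<mu> n) K1 \<le> measure (\<mu> n) K"
        by (rule prob_compact_mono[OF \<mu> K]) (simp add: K_def)
      with K1(2)[of n] show ?thesis by simp
    qed
    have \<nu>K: "measure \<nu> K > 1 - \<epsilon>"
    proof -
      have "measure \<nu> K2 \<le> measure \<nu> K"
        by (rule prob_compact_mono[OF \<nu> K]) (simp add: K_def)
      with K2(2) show ?thesis by simp
    qed
    obtain m :: nat where m: "m > 0" "1 / m < \<epsilon>"
      using real_arch_inverse[of \<epsilon>] \<open>\<epsilon> > 0\<close> by (auto simp: inverse_eq_divide)
    obtain h where h: "h \<in> increasing_span" "\<And>x. 0 \<le> h x" "\<And>x. h x \<le> 1"
      "\<And>x. x \<in> K \<Longrightarrow> \<bar>f x - h x\<bar> \<le> 1 / m"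
      using span_approximates_continuous[OF M K f m(1)] by blast
    have fm: "f \<in> borel_measurable borel" by (rule borel_measurable_continuous_onI[OF f(1)])
    note diff = integral_diff_le_compact[OF _ _ fm f(2,3) increasing_span_measurable[OF h(1)] h(2,3) K _ h(4)]
    have d\<mu>: "\<bar>(\<integral>x. f x \<partial>\<mu> n) - (\<integral>x. h x \<partial>\<mu> n)\<bar> \<le> 1 / m + \<epsilon>" for n
      by (rule diff[OF \<mu> \<mu>K]) auto
    have d\<nu>: "\<bar>(\<integral>x. f x \<partial>\<nu>) - (\<integral>x. h x \<partial>\<nu>)\<bar> \<le> 1 / m + \<epsilon>"
      by (rule diff[OF \<nu> \<nu>K]) auto
    have "(\<lambda>n. \<integral>x. h x \<partial>\<mu> n) \<longlonglongrightarrow> (\<integral>x. h x \<partial>\<nu>)"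
      by (rule increasing_span_integral_tendsto[OF \<mu> \<nu> lim h(1)])
    from LIMSEQ_D[OF this \<open>\<epsilon> > 0\<close>] obtain n0 where
      n0: "\<And>n. n \<ge> n0 \<Longrightarrow> \<bar>(\<integral>x. h x \<partial>\<mu> n) - (\<integral>x. h x \<partial>\<nu>)\<bar> < \<epsilon>"
      by auto
    have "\<bar>(\<integral>x. f x \<partial>\<mu> n) - (\<integral>x. f x \<partial>\<nu>)\<bar> < r" if "n \<ge> n0" for n
      using d\<mu>[of n] d\<nu> n0[OF that] m(2) unfolding \<epsilon>_def by linarith
    then show "\<exists>n0. \<forall>n\<ge>n0. norm ((\<integral>x. f x \<partial>\<mu> n) - (\<integral>x. f x \<partial>\<nu>)) < r"
      by auto
  qed
  show ?thesis
    unfolding converges_weakly_def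
  proof (intro allI impI, elim conjE)
    fix f :: "'a \<Rightarrow> real" assume f: "continuous_on UNIV f" "bounded (range f)"
    then obtain B where "B > 0" and B: "\<And>x. \<bar>f x\<bar> \<le> B"
      unfolding bounded_pos by auto
    define u where "u = (\<lambda>x. (f x + B) / (2 * B))"
    have u: "continuous_on UNIV u" "0 \<le> u x" "u x \<le> 1" for x
      using f(1) \<open>B > 0\<close> B[of x] by (auto simp: u_def divide_simps intro!: continuous_intros)
    have int: "(\<integral>x. f x \<partial>\<rho>) = 2 * B * (\<integral>x. u x \<partial>\<rho>) - B"
      if "prob_space \<rho>" "sets \<rho> = sets borel" for \<rho> :: "'a measure"
    proof -
      interpret prob_space \<rho> by fact
      have "u \<in> borel_measurable \<rho>"
        using borel_measurable_continuous_onI[OF u(1)] that(2) by (simp cong: measurable_cong_sets)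
      then have "integrable \<rho> u"
        using u(2,3) by (intro integrable_const_bound[of _ 1]) auto
      moreover have "f = (\<lambda>x. 2 * B * u x - B)"
        using \<open>B > 0\<close> by (auto simp: u_def)
      ultimately show ?thesis by (simp add: prob_space)
    qed
    show "(\<lambda>n. \<integral>x. f x \<partial>\<mu> n) \<longlonglongrightarrow> (\<integral>x. f x \<partial>\<nu>)"
      unfolding int[OF \<mu>] int[OF \<nu>] by (intro tendsto_intros unit u)
  qed
qed

text \<open>The indicator of a closed set is a pointwise limit of bounded continuous functions, and
  closed sets generate the Borel sets.\<close>

lemma prob_measure_eqI_continuous:
  fixes \<mu> \<nu> :: "'a::polish_space measure"
  assumes \<mu>: "prob_space \<mu>" "sets \<mu> = sets borel" and \<nu>: "prob_space \<nu>" "sets \<nu> = sets borel"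
    and eq: "\<And>f :: 'a \<Rightarrow> real. continuous_on UNIV f \<Longrightarrow> bounded (range f) \<Longrightarrow>
      (\<integral>x. f x \<partial>\<mu>) = (\<integral>x. f x \<partial>\<nu>)"
  shows "\<mu> = \<nu>"
proof (rule measure_eqI_generator_eq[where E = "Collect closed" and \<Omega> = UNIV and A = "\<lambda>_. UNIV"])
  show "sets \<mu> = sigma_sets UNIV (Collect closed)" "sets \<nu> = sigma_sets UNIV (Collect closed)"
    using \<mu>(2) \<nu>(2) by (simp_all add: borel_eq_closed)
  show "Int_stable (Collect closed :: 'a set set)" by (auto simp: Int_stable_def)
  show "emeasure \<mu> UNIV \<noteq> \<infinity>"
    using prob_space.emeasure_space_1[OF \<mu>(1)] sets_eq_imp_space_eq[OF \<mu>(2)] by simp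
  fix C :: "'a set" assume "C \<in> Collect closed"
  then have C: "closed C" by simp
  show "emeasure \<mu> C = emeasure \<nu> C"
  proof (cases "C = {}")
    case False
    define f where "f = (\<lambda>n x. max 0 (1 - real n * infdist x C))"
    have f: "continuous_on UNIV (f n)" "0 \<le> f n x" "f n x \<le> 1" for n x
      by (auto simp: f_def infdist_nonneg intro!: continuous_intros)
    have lim: "(\<lambda>n. f n x) \<longlonglongrightarrow> indicator C x" for x
    proof (cases "x \<in> C")
      case True
      then show ?thesis by (simp add: f_def)
    next
      case False
      then have "infdist x C > 0"
        using in_closed_iff_infdist_zero[OF C \<open>C \<noteq> {}\<close>] infdist_nonneg[of x C] by fastforce
      then obtain k :: nat where k: "1 < real k * infdist x C"
        using reals_Archimedean3 by blast
      have "f n x = 0" if "n \<ge> k" for n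
      proof -
        have "real k * infdist x C \<le> real n * infdist x C"
          using that \<open>infdist x C > 0\<close> by (intro mult_right_mono) auto
        then show ?thesis using k by (simp add: f_def)
      qed
      then show ?thesis
        using False by (intro tendsto_eventually) (auto simp: eventually_sequentially)
    qed
    have conv: "(\<lambda>n. \<integral>x. f n x \<partial>\<rho>) \<longlonglongrightarrow> measure \<rho> C"
      if "prob_space \<rho>" "sets \<rho> = sets borel" for \<rho> :: "'a measure"
    proof -
      interpret prob_space \<rho> by fact
      have [measurable]: "f n \<in> borel_measurable \<rho>" for n
        using borel_measurable_continuous_onI[OF f(1)] that(2) by (simp cong: measurable_cong_sets)
      have [measurable]: "C \<in> sets \<rho>" using C that(2) by simp
      have "(\<lambda>n. \<integral>x. f n x \<partial>\<rho>) \<longlonglongrightarrow> (\<integral>x. indicator C x \<partial>\<rho>)"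
        by (rule integral_dominated_convergence[where w = "\<lambda>_. 1"])
          (use lim f(2,3) in auto)
      then show ?thesis by simp
    qed
    have "bounded (range (f n))" for n
      using f(2,3) by (intro boundedI[of _ 1]) auto
    from eq[OF f(1) this] have "measure \<mu> C = measure \<nu> C"
      using LIMSEQ_unique[OF conv[OF \<mu>]] conv[OF \<nu>] by simp
    then show ?thesis
      using \<mu>(1) \<nu>(1) by (simp add: finite_measure.emeasure_eq_measure prob_space.finite_measure)
  qed simp
qed auto

text \<open>A constant sequence is tight, so it converges weakly to every measure with the same
  integrals of increasing functions.\<close>

lemma increasing_functions_determine_measure:
  fixes \<mu> \<nu> :: "'a::{polish_space, order} measure"
  assumes M: "closed (order_graph :: ('a \<times> 'a) set)"
    and \<mu>: "prob_space \<mu>" "sets \<mu> = sets borel" and \<nu>: "prob_space \<nu>" "sets \<nu> = sets borel"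
    and eq: "\<And>g. g \<in> increasing_functions \<Longrightarrow> (\<integral>x. g x \<partial>\<mu>) = (\<integral>x. g x \<partial>\<nu>)"
  shows "\<mu> = \<nu>"
proof (rule prob_measure_eqI_continuous[OF \<mu> \<nu>])
  have "tight_sequence (\<lambda>_. \<mu>)"
    unfolding tight_sequence_def using prob_inner_compact[OF \<mu>] by metis
  then have weak: "converges_weakly (\<lambda>_. \<mu>) \<nu>"
    by (rule weak_convergence_if_tight[OF M \<mu> \<nu>]) (simp add: eq)
  fix f :: "'a \<Rightarrow> real" assume "continuous_on UNIV f" "bounded (range f)"
  with weak have "(\<lambda>_::nat. \<integral>x. f x \<partial>\<mu>) \<longlonglongrightarrow> (\<integral>x. f x \<partial>\<nu>)"
    unfolding converges_weakly_def by blast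
  then show "(\<integral>x. f x \<partial>\<mu>) = (\<integral>x. f x \<partial>\<nu>)"
    by (simp add: LIMSEQ_const_iff)
qed

text \<open>For compact \<open>C\<close> of large \<open>\<nu>\<close>-mass the indicators of \<open>i(C)\<close> and of the complement of \<open>d(C)\<close>
  are increasing. Hence \<open>i(C) \<inter> d(C)\<close>, which is compact, eventually has large mass. Each of
  the finitely many remaining measures is tight by itself.\<close>

lemma tight_if_KS_normal:
  fixes \<mu> :: "nat \<Rightarrow> 'a::{polish_space, order} measure"
  assumes M: "closed (order_graph :: ('a \<times> 'a) set)" and KS: "KS_normal TYPE('a)"
    and \<mu>: "\<And>n. prob_space (\<mu> n)" "\<And>n. sets (\<mu> n) = sets borel"
    and \<nu>: "prob_space \<nu>" "sets \<nu> = sets borel"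
    and lim: "\<And>g. g \<in> increasing_functions \<Longrightarrow> (\<lambda>n. \<integral>x. g x \<partial>\<mu> n) \<longlonglongrightarrow> (\<integral>x. g x \<partial>\<nu>)"
  shows "tight_sequence \<mu>"
  unfolding tight_sequence_def
proof (intro allI impI)
  fix \<epsilon> :: real assume "\<epsilon> > 0"
  then have "\<epsilon> / 2 > 0" by simp
  from prob_inner_compact[OF \<nu> this] obtain C where C: "compact C" "measure \<nu> C > 1 - \<epsilon> / 2" .
  define I where "I = increasing_hull C"
  define D where "D = decreasing_hull C"
  have cl: "closed I" "closed D"
    unfolding I_def D_def by (rule increasing_hull_closed decreasing_hull_closed M C(1))+
  have ID: "compact (I \<inter> D)"
    using KS C(1) unfolding KS_normal_def I_def D_def by blast
  have sub: "C \<subseteq> I" "C \<subseteq> D" by (auto simp: I_def D_def increasing_hull_def decreasing_hull_def)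
  have I_lim: "(\<lambda>n. measure (\<mu> n) I) \<longlonglongrightarrow> measure \<nu> I"
    using lim[OF indicator_increasing_hull[OF M C(1)]] cl(1) \<mu>(2) \<nu>(2) sets_eq_imp_space_eq[OF \<mu>(2)]
      sets_eq_imp_space_eq[OF \<nu>(2)]
    by (simp add: I_def)
  have Dc_lim: "(\<lambda>n. measure (\<mu> n) (- D)) \<longlonglongrightarrow> measure \<nu> (- D)"
    using lim[OF indicator_decreasing_hull[OF M C(1)]] cl(2) \<mu>(2) \<nu>(2) sets_eq_imp_space_eq[OF \<mu>(2)]
      sets_eq_imp_space_eq[OF \<nu>(2)]
    by (simp add: D_def)
  have "measure \<nu> C \<le> measure \<nu> I" "measure \<nu> C \<le> measure \<nu> D"
    using cl sub \<nu> by (auto intro!: finite_measure.finite_measure_mono prob_space.finite_measure)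
  moreover have compl: "measure \<rho> (- D) = 1 - measure \<rho> D"
    if "prob_space \<rho>" "sets \<rho> = sets borel" for \<rho> :: "'a measure"
    using prob_space.prob_compl[OF that(1), of D] cl(2) that(2) sets_eq_imp_space_eq[OF that(2)]
    by (simp add: Compl_eq_Diff_UNIV)
  ultimately have "measure \<nu> I > 1 - \<epsilon> / 2" "measure \<nu> (- D) < \<epsilon> / 2"
    using C(2) compl[OF \<nu>] by auto
  then have "eventually (\<lambda>n. measure (\<mu> n) I > 1 - \<epsilon> / 2 \<and> measure (\<mu> n) (- D) < \<epsilon> / 2) sequentially"
    by (intro eventually_conj order_tendstoD(1)[OF I_lim] order_tendstoD(2)[OF Dc_lim])
  then obtain n0 where n0:
    "\<And>n. n \<ge> n0 \<Longrightarrow> measure (\<mu> n) I > 1 - \<epsilon> / 2 \<and> measure (\<mu> n) (- D) < \<epsilon> / 2"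
    unfolding eventually_sequentially by blast
  have late: "measure (\<mu> n) (I \<inter> D) > 1 - \<epsilon>" if "n \<ge> n0" for n
  proof -
    interpret prob_space "\<mu> n" by (rule \<mu>)
    have "measure (\<mu> n) I \<le> measure (\<mu> n) ((I \<inter> D) \<union> (- D))"
      using cl \<mu>(2) by (intro finite_measure_mono) auto
    also have "\<dots> \<le> measure (\<mu> n) (I \<inter> D) + measure (\<mu> n) (- D)"
      using cl \<mu>(2) by (intro measure_Un_le) auto
    finally show ?thesis using n0[OF that] by auto
  qed
  have "\<forall>n. \<exists>K. compact K \<and> measure (\<mu> n) K > 1 - \<epsilon>"
    using prob_inner_compact[OF \<mu> \<open>\<epsilon> > 0\<close>] by metis
  then obtain L where L: "\<And>n. compact (L n)" "\<And>n. measure (\<mu> n) (L n) > 1 - \<epsilon>"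
    by metis
  define K where "K = (I \<inter> D) \<union> (\<Union>n<n0. L n)"
  have K: "compact K"
    unfolding K_def by (intro compact_Un ID compact_UN) (auto simp: L)
  have "measure (\<mu> n) K > 1 - \<epsilon>" for n
  proof -
    have "measure (\<mu> n) (if n < n0 then L n else I \<inter> D) \<le> measure (\<mu> n) K"
      by (rule prob_compact_mono[OF \<mu> K]) (auto simp: K_def)
    then show ?thesis using late[of n] L(2)[of n] by (auto split: if_splits)
  qed
  with K show "\<exists>K. compact K \<and> (\<forall>n. measure (\<mu> n) K > 1 - \<epsilon>)" by blast
qed

section \<open>Convergence of the chain\<close>

theorem theorem3p2:
  fixes P :: "'a::{polish_space, order} \<Rightarrow> 'a measure"
    and N :: "'a \<Rightarrow> 'v measure"
    and X :: "'a \<Rightarrow> nat \<Rightarrow> 'v \<Rightarrow> 'a"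
    and Q :: "'a \<Rightarrow> 'a \<Rightarrow> 'w measure"
    and U V :: "'a \<Rightarrow> 'a \<Rightarrow> nat \<Rightarrow> 'w \<Rightarrow> 'a"
  assumes "closed (order_graph :: ('a \<times> 'a) set)"
    and "P \<in> borel \<rightarrow>\<^sub>M prob_algebra borel"
    and "stochastically_monotone P"
    and "\<And>x. markov_chain P x (N x) (X x)"
    and "achievable TYPE('w) P order_graph"
    and "\<And>x y. successful_coupling P order_graph x y (Q x y) (U x y) (V x y)"
  shows
    "(\<forall>x y.
       let r = (\<lambda>n. max
             (measure (Q x y) {\<omega> \<in> space (Q x y). hitting_time order_graph (U x y) (V x y) \<omega> > enat n})
             (measure (Q y x) {\<omega> \<in> space (Q y x). hitting_time order_graph (U y x) (V y x) \<omega> > enat n}))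
       in (\<forall>n. (SUP g\<in>increasing_functions.
                  \<bar>(\<integral>\<omega>. g (X x n \<omega>) \<partial>N x) - (\<integral>\<omega>. g (X y n \<omega>) \<partial>N y)\<bar>) \<le> r n) \<and>
          r \<longlonglongrightarrow> 0) \<and>
     (\<forall>\<pi>. stationary_distribution P \<pi> \<longrightarrow>
       (\<forall>\<pi>'. stationary_distribution P \<pi>' \<longrightarrow> \<pi>' = \<pi>) \<and>
       (\<forall>x.
         let a = (\<lambda>n. SUP g\<in>increasing_functions.
                        \<bar>(\<integral>\<omega>. g (X x n \<omega>) \<partial>N x) - (\<integral>y. g y \<partial>\<pi>)\<bar>);
             b = (\<lambda>n. SUP g\<in>increasing_functions.
                        \<integral>y. \<bar>(\<integral>\<omega>. g (X x n \<omega>) \<partial>N x) - (\<integral>\<omega>. g (X y n \<omega>) \<partial>N y)\<bar> \<partial>\<pi>)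
         in convergent a \<and> convergent b \<and> lim a \<le> lim b \<and> lim b = 0) \<and>
       (KS_normal TYPE('a) \<longrightarrow>
         (\<forall>y. converges_weakly (\<lambda>n. distr (N y) borel (X y n)) \<pi>)) \<and>
       (\<forall>x. tight_sequence (\<lambda>n. distr (N x) borel (X x n)) \<longrightarrow>
         converges_weakly (\<lambda>n. distr (N x) borel (X x n)) \<pi>))"
proof -
  note closed = assms(1) and P = assms(2) and mono = assms(3)
  have chain: "prob_space (N x)" "\<And>n. X x n \<in> borel_measurable (N x)"
    "\<And>\<omega>. \<omega> \<in> space (N x) \<Longrightarrow> X x 0 \<omega> = x"
    "markov_transitions (N x) (history (N x) (X x)) P (X x)" for x
    using assms(4)[of x] unfolding markov_chain_def by auto
  have E: "(\<integral>\<omega>. g (X x n \<omega>) \<partial>N x) = (kernel_op P ^^ n) g x" if "g \<in> increasing_functions" for g x n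
    by (rule markov_expectation[OF chain(1) subalgebra_history[OF chain(2)] chain(2) P mono chain(4,3) that])
  define t where "t x y n = measure (Q x y)
    {\<omega> \<in> space (Q x y). hitting_time order_graph (U x y) (V x y) \<omega> > enat n}" for x y n
  define r where "r x y = (\<lambda>n. max (t x y n) (t y x n))" for x y
  have "t x y \<longlonglongrightarrow> 0" for x y
    unfolding t_def by (rule hitting_time_tail_tendsto_0[OF borel_closed[OF closed] assms(6)])
  then have r0: "r x y \<longlonglongrightarrow> 0" for x y
    unfolding r_def using tendsto_max[of "t x y" 0 sequentially "t y x" 0] by simp
  have coupled: "\<bar>(kernel_op P ^^ n) g x - (kernel_op P ^^ n) g y\<bar> \<le> r x y n"
    if "g \<in> increasing_functions" for g x y n
  proof -
    have "(kernel_op P ^^ n) g x - (kernel_op P ^^ n) g y \<le> t x y n" for x y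
      unfolding t_def using assms(6)[of x y] that
      by (intro coupling_inequality[OF closed P mono]) (auto simp: successful_coupling_def)
    from this[of x y] this[of y x] show ?thesis unfolding r_def by linarith
  qed
  have part1: "(SUP g\<in>increasing_functions.
      \<bar>(\<integral>\<omega>. g (X x n \<omega>) \<partial>N x) - (\<integral>\<omega>. g (X y n \<omega>) \<partial>N y)\<bar>) \<le> r x y n" for x y n
    by (rule cSUP_least[OF increasing_functions_nonempty]) (simp add: E coupled)
  have stat: "(\<forall>\<pi>'. stationary_distribution P \<pi>' \<longrightarrow> \<pi>' = \<pi>) \<and>
       (\<forall>x.
         let a = (\<lambda>n. SUP g\<in>increasing_functions.
                        \<bar>(\<integral>\<omega>. g (X x n \<omega>) \<partial>N x) - (\<integral>y. g y \<partial>\<pi>)\<bar>);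
             b = (\<lambda>n. SUP g\<in>increasing_functions.
                        \<integral>y. \<bar>(\<integral>\<omega>. g (X x n \<omega>) \<partial>N x) - (\<integral>\<omega>. g (X y n \<omega>) \<partial>N y)\<bar> \<partial>\<pi>)
         in convergent a \<and> convergent b \<and> lim a \<le> lim b \<and> lim b = 0) \<and>
       (KS_normal TYPE('a) \<longrightarrow>
         (\<forall>y. converges_weakly (\<lambda>n. distr (N y) borel (X y n)) \<pi>)) \<and>
       (\<forall>x. tight_sequence (\<lambda>n. distr (N x) borel (X x n)) \<longrightarrow>
         converges_weakly (\<lambda>n. distr (N x) borel (X x n)) \<pi>)"
    if \<pi>: "stationary_distribution P \<pi>" for \<pi>
  proof -
    have prob: "prob_space \<rho>" "sets \<rho> = sets borel" if "stationary_distribution P \<rho>" for \<rho>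
      using that unfolding stationary_distribution_def by auto
    define a where "a \<rho> x = (\<lambda>n. SUP g\<in>increasing_functions.
        \<bar>(\<integral>\<omega>. g (X x n \<omega>) \<partial>N x) - (\<integral>y. g y \<partial>\<rho>)\<bar>)" for \<rho> x
    define b where "b \<rho> x = (\<lambda>n. SUP g\<in>increasing_functions.
        \<integral>y. \<bar>(\<integral>\<omega>. g (X x n \<omega>) \<partial>N x) - (\<integral>\<omega>. g (X y n \<omega>) \<partial>N y)\<bar> \<partial>\<rho>)" for \<rho> x
    have b_eq: "b \<rho> x n = (SUP g\<in>increasing_functions.
        \<integral>y. \<bar>(kernel_op P ^^ n) g x - (kernel_op P ^^ n) g y\<bar> \<partial>\<rho>)" for \<rho> x n
      unfolding b_def by (intro SUP_cong refl) (simp add: E)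
    have b0: "b \<rho> x \<longlonglongrightarrow> 0" if "stationary_distribution P \<rho>" for \<rho> x
      unfolding b_eq by (rule kernel_op_uniform_averaging(1)[OF mono prob[OF that] r0 coupled])
    have le_b: "\<bar>(\<integral>\<omega>. g (X x n \<omega>) \<partial>N x) - (\<integral>y. g y \<partial>\<rho>)\<bar> \<le> b \<rho> x n"
      if "stationary_distribution P \<rho>" "g \<in> increasing_functions" for \<rho> x n g
      unfolding E[OF that(2)] b_eq
      by (rule order_trans[OF kernel_op_stationary_distance_le[OF P mono that]
          kernel_op_uniform_averaging(2)[OF mono prob[OF that(1)] r0 coupled that(2)]])
    have lim: "(\<lambda>n. \<integral>\<omega>. g (X x n \<omega>) \<partial>N x) \<longlonglongrightarrow> (\<integral>y. g y \<partial>\<rho>)"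
      if "stationary_distribution P \<rho>" "g \<in> increasing_functions" for \<rho> x g
      by (rule LIM_zero_cancel, rule Lim_null_comparison[OF _ b0[OF that(1), of x]])
        (use le_b[OF that] in simp)
    have a_le: "a \<pi> x n \<le> b \<pi> x n" for x n
      unfolding a_def by (rule cSUP_least[OF increasing_functions_nonempty le_b[OF \<pi>]])
    have "0 \<le> a \<pi> x n" for x n
    proof -
      obtain g :: "'a \<Rightarrow> real" where g: "g \<in> increasing_functions"
        using increasing_functions_nonempty by blast
      have "bdd_above ((\<lambda>g. \<bar>(\<integral>\<omega>. g (X x n \<omega>) \<partial>N x) - (\<integral>y. g y \<partial>\<pi>)\<bar>) ` increasing_functions)"
        using le_b[OF \<pi>] by (intro bdd_aboveI2)
      from cSUP_upper[OF g this] show ?thesis unfolding a_def by linarith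
    qed
    then have a0: "a \<pi> x \<longlonglongrightarrow> 0" for x
      by (intro tendsto_sandwich[OF _ _ tendsto_const b0[OF \<pi>, of x]]) (auto simp: a_le)
    have unique: "\<pi>' = \<pi>" if "stationary_distribution P \<pi>'" for \<pi>'
      by (rule increasing_functions_determine_measure[OF closed prob[OF that] prob[OF \<pi>]])
        (rule LIMSEQ_unique[OF lim[OF that] lim[OF \<pi>]])
    define \<mu> where "\<mu> x = (\<lambda>n. distr (N x) borel (X x n))" for x
    have \<mu>: "prob_space (\<mu> x n)" "sets (\<mu> x n) = sets borel" for x n
      unfolding \<mu>_def by (rule prob_space.prob_space_distr[OF chain(1,2)]) simp
    have \<mu>_lim: "(\<lambda>n. \<integral>z. g z \<partial>\<mu> x n) \<longlonglongrightarrow> (\<integral>y. g y \<partial>\<pi>)"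
      if "g \<in> increasing_functions" for g x
      unfolding \<mu>_def integral_distr[OF chain(2) increasing_functionsD(1)[OF that]]
      by (rule lim[OF \<pi> that])
    have weak: "converges_weakly (\<mu> x) \<pi>" if "tight_sequence (\<mu> x)" for x
      by (rule weak_convergence_if_tight[OF closed \<mu> prob[OF \<pi>] that \<mu>_lim])
    have "tight_sequence (\<mu> x)" if "KS_normal TYPE('a)" for x
      by (rule tight_if_KS_normal[OF closed that \<mu> prob[OF \<pi>] \<mu>_lim])
    with weak have KS: "KS_normal TYPE('a) \<longrightarrow> (\<forall>y. converges_weakly (\<mu> y) \<pi>)" by blast
    have lims: "convergent (a \<pi> x) \<and> convergent (b \<pi> x) \<and> lim (a \<pi> x) \<le> lim (b \<pi> x) \<and> lim (b \<pi> x) = 0" for x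
      using a0[of x] b0[OF \<pi>, of x] by (auto simp: convergentI limI)
    show ?thesis
      unfolding Let_def a_def[symmetric] b_def[symmetric] \<mu>_def[symmetric]
      by (intro conjI allI impI unique KS[rule_format] weak)
        (use lims in blast)+
  qed
  show ?thesis
    unfolding Let_def t_def[symmetric] r_def[symmetric]
  proof (rule conjI, goal_cases)
    case 1
    show ?case by (intro conjI allI part1 r0)
  next
    case 2
    show ?case by (intro allI impI) (rule stat[unfolded Let_def])
  qed
qed

end
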